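(* Let $0<\alpha<1$, $\theta=\alpha/2$, and let $0=t_0<t_1<\cdots<t_N=T$ be time levels whose local step-size ratios satisfy $\rho_k\le7/4$ for $1\le k\le N-1$. Let $v\in C([0,T])\cap C^3((0,T])$ be such that the quantities $G^k_{\mathrm{loc}}$ ($1\le k\le N$) and $G^k_{\mathrm{his}}$ ($1\le k\le N-1$) defined in the context are finite. Let $\Upsilon^{n-\theta}=(\mathcal{D}^\alpha_tv)(t_{n-\theta})-(\mathcal{D}^\alpha_\tau v)^{n-\theta}$ be the local consistency error of the nonuniform Alikhanov formula. Then $$|\Upsilon^{n-\theta}|\leq A_{0}^{(n)}G^n_{\mathrm{loc}}+\sum_{k=1}^{n-1}\big(A_{n-k-1}^{(n)}-A_{n-k}^{(n)}\big)G^k_{\mathrm{his}}\qquad\text{for }1\leq n\leq N,$$ and consequently the global consistency error $\mathcal{E}^n_{\mathrm{glob}}=\sum_{k=1}^nP^{(n)}_{n-k}|\Upsilon^{k-\theta}|$ satisfies $$\mathcal{E}_{\mathrm{glob}}^n\leq\sum_{k=1}^nP_{n-k}^{(n)}A_0^{(k)}G^k_{\mathrm{loc}}+\sum_{k=1}^{n-1}P_{n-k}^{(n)}A_{0}^{(k)}G^k_{\mathrm{his}}\qquad\text{for }1\leq n\leq N.$$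
   Context: Notation. $\omega_\beta(t)=t^{\beta-1}/\Gamma(\beta)$ for $t>0$; Caputo derivative $(\mathcal{D}^\alpha_tv)(t)=\int_0^t\omega_{1-\alpha}(t-s)v'(s)\,ds$. Step sizes $\tau_k=t_k-t_{k-1}$ ($1\le k\le N$), ratios $\rho_k=\tau_k/\tau_{k+1}$ ($1\le k\le N-1$), $t_{n-\theta}=\theta t_{n-1}+(1-\theta)t_n$, $t_{k-1/2}=(t_{k-1}+t_k)/2$, $\varpi_n'(s)=\omega_{1-\alpha}(t_{n-\theta}-s)$ for $0\le s<t_{n-\theta}$. Coefficients: $$a^{(n)}_{n-k}=\frac{1}{\tau_k}\int_{t_{k-1}}^{\min\{t_k,t_{n-\theta}\}}\varpi_n'(s)\,ds\quad(1\le k\le n),$$ $$b^{(n)}_{n-k}=\frac{2}{\tau_k(\tau_k+\tau_{k+1})}\int_{t_{k-1}}^{t_k}(s-t_{k-1/2})\varpi_n'(s)\,ds\quad(1\le k\le n-1).$$ Alikhanov kernels: $A^{(1)}_0=a^{(1)}_0$ and, for $n\ge2$, $$A^{(n)}_{0}=a^{(n)}_0+\rho_{n-1}b^{(n)}_1,\qquad A^{(n)}_{n-k}=a^{(n)}_{n-k}+\rho_{k-1}b^{(n)}_{n-k+1}-b^{(n)}_{n-k}\ (2\le k\le n-1),\qquad A^{(n)}_{n-1}=a^{(n)}_{n-1}-b^{(n)}_{n-1}.$$ Discrete Caputo (Alikhanov) formula: $(\mathcal{D}^\alpha_\tau v)^{n-\theta}=\sum_{k=1}^nA^{(n)}_{n-k}\big(v(t_k)-v(t_{k-1})\big)$.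 Complementary discrete kernels: $P^{(n)}_0=1/A^{(n)}_0$ and $$P^{(n)}_{n-j}=\frac{1}{A^{(j)}_0}\sum_{k=j+1}^n\big(A^{(k)}_{k-j-1}-A^{(k)}_{k-j}\big)P^{(n)}_{n-k},\quad 1\le j\le n-1.$$ Error quantities: $$G^k_{\mathrm{loc}}=\frac32\int_{t_{k-1}}^{t_{k-1/2}}(s-t_{k-1})^2|v'''(s)|\,ds+\frac{3\tau_k}{2}\int_{t_{k-1/2}}^{t_k}(t_k-s)|v'''(s)|\,ds,$$ $$G^k_{\mathrm{his}}=\frac52\int_{t_{k-1}}^{t_k}(s-t_{k-1})^2|v'''(s)|\,ds+\frac52\int_{t_k}^{t_{k+1}}(t_{k+1}-s)^2|v'''(s)|\,ds.$$ *)

theory Defs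
  imports "HOL-Analysis.Analysis"
begin

text \<open>
  A mesh is a function \<open>t :: nat \<Rightarrow> real\<close>, of which only \<open>t 0, \<dots>, t N\<close> matter.
  The lower index of the kernels \<open>coeff_a\<close>, \<open>coeff_b\<close>, \<open>kern_A\<close> and \<open>kern_P\<close>
  is the one of the usual notation: \<open>kern_A \<alpha> \<theta> t n (n - k)\<close> is
  $A^{(n)}_{n-k}$, and so on; a lower index \<open>j\<close> thus belongs to the subinterval number
  \<open>k = n - j\<close>. All integrals are Lebesgue integrals over open intervals, so that one-sided or
  missing derivatives at the end points never enter.
\<close>

definition omega :: "real \<Rightarrow> real \<Rightarrow> real" where
  "omega \<beta> x = x powr (\<beta> - 1) / Gamma \<beta>"

text \<open>
  The integral converges absolutely for the functions considered here: with \<open>v'''\<close> the third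
  derivative of \<open>v\<close>, integrability of \<open>s^2 * \<bar>v''' s\<bar>\<close> near 0 makes \<open>deriv v\<close> integrable there.
\<close>

definition caputo :: "real \<Rightarrow> (real \<Rightarrow> real) \<Rightarrow> real \<Rightarrow> real" where
  "caputo \<alpha> v x = (LBINT s:{0<..<x}. omega (1 - \<alpha>) (x - s) * deriv v s)"

text \<open>Derivatives are taken within \<open>S\<close>, hence one-sided at an end point belonging to \<open>S\<close>.\<close>

primrec Ck_on :: "nat \<Rightarrow> real set \<Rightarrow> (real \<Rightarrow> real) \<Rightarrow> bool" where
  "Ck_on 0 S f \<longleftrightarrow> continuous_on S f"
| "Ck_on (Suc k) S f \<longleftrightarrow>
     (\<exists>f'. (\<forall>x\<in>S. (f has_real_derivative f' x) (at x within S)) \<and> Ck_on k S f')"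

definition tau :: "(nat \<Rightarrow> real) \<Rightarrow> nat \<Rightarrow> real" where
  "tau t k = t k - t (k - 1)"

definition rho :: "(nat \<Rightarrow> real) \<Rightarrow> nat \<Rightarrow> real" where
  "rho t k = tau t k / tau t (k + 1)"

definition t_off :: "real \<Rightarrow> (nat \<Rightarrow> real) \<Rightarrow> nat \<Rightarrow> real" where
  "t_off \<theta> t n = \<theta> * t (n - 1) + (1 - \<theta>) * t n"

definition t_mid :: "(nat \<Rightarrow> real) \<Rightarrow> nat \<Rightarrow> real" where
  "t_mid t k = (t (k - 1) + t k) / 2"

definition varpi' :: "real \<Rightarrow> real \<Rightarrow> (nat \<Rightarrow> real) \<Rightarrow> nat \<Rightarrow> real \<Rightarrow> real" where
  "varpi' \<alpha> \<theta> t n s = omega (1 - \<alpha>) (t_off \<theta> t n - s)"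

definition coeff_a :: "real \<Rightarrow> real \<Rightarrow> (nat \<Rightarrow> real) \<Rightarrow> nat \<Rightarrow> nat \<Rightarrow> real" where
  "coeff_a \<alpha> \<theta> t n j = (let k = n - j in
     1 / tau t k * (LBINT s:{t (k - 1)<..<min (t k) (t_off \<theta> t n)}. varpi' \<alpha> \<theta> t n s))"

definition coeff_b :: "real \<Rightarrow> real \<Rightarrow> (nat \<Rightarrow> real) \<Rightarrow> nat \<Rightarrow> nat \<Rightarrow> real" where
  "coeff_b \<alpha> \<theta> t n j = (let k = n - j in
     2 / (tau t k * (tau t k + tau t (k + 1))) *
       (LBINT s:{t (k - 1)<..<t k}. (s - t_mid t k) * varpi' \<alpha> \<theta> t n s))"

definition kern_A :: "real \<Rightarrow> real \<Rightarrow> (nat \<Rightarrow> real) \<Rightarrow> nat \<Rightarrow> nat \<Rightarrow> real" where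
  "kern_A \<alpha> \<theta> t n j =
    (if n = 1 then coeff_a \<alpha> \<theta> t 1 0
     else if j = 0 then coeff_a \<alpha> \<theta> t n 0 + rho t (n - 1) * coeff_b \<alpha> \<theta> t n 1
     else if j = n - 1 then coeff_a \<alpha> \<theta> t n (n - 1) - coeff_b \<alpha> \<theta> t n (n - 1)
     else coeff_a \<alpha> \<theta> t n j + rho t (n - j - 1) * coeff_b \<alpha> \<theta> t n (j + 1)
            - coeff_b \<alpha> \<theta> t n j)"

definition alikhanov :: "real \<Rightarrow> real \<Rightarrow> (nat \<Rightarrow> real) \<Rightarrow> (real \<Rightarrow> real) \<Rightarrow> nat \<Rightarrow> real" where
  "alikhanov \<alpha> \<theta> t v n = (\<Sum>k=1..n. kern_A \<alpha> \<theta> t n (n - k) * (v (t k) - v (t (k - 1))))"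

text \<open>Here \<open>m = n - j\<close>, so that \<open>n - m\<close> below is the index \<open>j\<close> of the usual recursion.\<close>

function kern_P :: "real \<Rightarrow> real \<Rightarrow> (nat \<Rightarrow> real) \<Rightarrow> nat \<Rightarrow> nat \<Rightarrow> real" where
  "kern_P \<alpha> \<theta> t n m =
    (if m = 0 then 1 / kern_A \<alpha> \<theta> t n 0
     else 1 / kern_A \<alpha> \<theta> t (n - m) 0 *
       (\<Sum>k = n - m + 1..n.
          (kern_A \<alpha> \<theta> t k (k - (n - m) - 1) - kern_A \<alpha> \<theta> t k (k - (n - m)))
            * kern_P \<alpha> \<theta> t n (n - k)))"
  by pat_completeness auto
termination
  by (relation "Wellfounded.measure (\<lambda>(\<alpha>, \<theta>, t, n, m). m)") auto

declare kern_P.simps [simp del]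

definition G_loc :: "(nat \<Rightarrow> real) \<Rightarrow> (real \<Rightarrow> real) \<Rightarrow> nat \<Rightarrow> real" where
  "G_loc t v k =
     3 / 2 * (LBINT s:{t (k - 1)<..<t_mid t k}. (s - t (k - 1))^2 * \<bar>(deriv ^^ 3) v s\<bar>)
   + 3 * tau t k / 2 * (LBINT s:{t_mid t k<..<t k}. (t k - s) * \<bar>(deriv ^^ 3) v s\<bar>)"

definition G_his :: "(nat \<Rightarrow> real) \<Rightarrow> (real \<Rightarrow> real) \<Rightarrow> nat \<Rightarrow> real" where
  "G_his t v k =
     5 / 2 * (LBINT s:{t (k - 1)<..<t k}. (s - t (k - 1))^2 * \<bar>(deriv ^^ 3) v s\<bar>)
   + 5 / 2 * (LBINT s:{t k<..<t (k + 1)}. (t (k + 1) - s)^2 * \<bar>(deriv ^^ 3) v s\<bar>)"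

text \<open>
  The Lebesgue integral of a non-integrable function is 0 in HOL, so finiteness of
  \<open>G_loc\<close> and \<open>G_his\<close> has to be stated as integrability of their (nonnegative) integrands.
\<close>

definition G_loc_finite :: "(nat \<Rightarrow> real) \<Rightarrow> (real \<Rightarrow> real) \<Rightarrow> nat \<Rightarrow> bool" where
  "G_loc_finite t v k \<longleftrightarrow>
     set_integrable lborel {t (k - 1)<..<t_mid t k} (\<lambda>s. (s - t (k - 1))^2 * \<bar>(deriv ^^ 3) v s\<bar>)
   \<and> set_integrable lborel {t_mid t k<..<t k} (\<lambda>s. (t k - s) * \<bar>(deriv ^^ 3) v s\<bar>)"

definition G_his_finite :: "(nat \<Rightarrow> real) \<Rightarrow> (real \<Rightarrow> real) \<Rightarrow> nat \<Rightarrow> bool" where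
  "G_his_finite t v k \<longleftrightarrow>
     set_integrable lborel {t (k - 1)<..<t k} (\<lambda>s. (s - t (k - 1))^2 * \<bar>(deriv ^^ 3) v s\<bar>)
   \<and> set_integrable lborel {t k<..<t (k + 1)} (\<lambda>s. (t (k + 1) - s)^2 * \<bar>(deriv ^^ 3) v s\<bar>)"

definition local_error :: "real \<Rightarrow> real \<Rightarrow> (nat \<Rightarrow> real) \<Rightarrow> (real \<Rightarrow> real) \<Rightarrow> nat \<Rightarrow> real" where
  "local_error \<alpha> \<theta> t v n = caputo \<alpha> v (t_off \<theta> t n) - alikhanov \<alpha> \<theta> t v n"

definition global_error :: "real \<Rightarrow> real \<Rightarrow> (nat \<Rightarrow> real) \<Rightarrow> (real \<Rightarrow> real) \<Rightarrow> nat \<Rightarrow> real" where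
  "global_error \<alpha> \<theta> t v n =
     (\<Sum>k=1..n. kern_P \<alpha> \<theta> t n (n - k) * \<bar>local_error \<alpha> \<theta> t v k\<bar>)"

end

theory Submission
  imports Defs
begin

text \<open>
Write \<open>S\<close> for the offset point \<open>t_off \<theta> t n\<close>, \<open>w = varpi' \<alpha> \<theta> t n\<close> for the kernel of the Caputo
derivative at \<open>S\<close>, and \<open>\<tau>\<^sub>k\<close>, \<open>\<rho>\<^sub>k\<close> for step sizes and their ratios. The Alikhanov formula is the integral
of \<open>w\<close> against the derivative of an interpolant of \<open>v\<close>: on a past cell the quadratic through its two
end points and the next mesh point, on the current cell the linear one. So the local error is a sum
over the cells of \<open>\<integral> w * (interpolation error)'\<close>.

On a past cell the interpolation error vanishes at both ends, so integration by parts moves the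
derivative to \<open>w\<close>, and a Peano kernel estimate (\<open>quad_interp_error_bound\<close>) bounds the piece by
\<open>left_moment n k / \<tau>\<^sub>k * (h\<^sub>1 / 2) + \<rho>\<^sub>k * b * (h\<^sub>2 / 2)\<close>. Here \<open>h\<^sub>1\<close> and \<open>h\<^sub>2\<close> are the two integrals in
\<open>G_his\<close>, \<open>left_moment n k\<close> is the integral of \<open>(t\<^sub>k - s) * w'\<close> over the cell, and \<open>b\<close> is the coefficient
\<open>coeff_b\<close> of the cell. The link to the discrete kernels is \<open>kern_A_diff_ge\<close>: consecutive kernels differ
by at least \<open>left_moment n k / (5 * \<tau>\<^sub>k) + (1 + \<rho>\<^sub>k) * b\<close>. It holds because \<open>w\<close> and its derivative increase:
comparing the averages of \<open>w\<close> over neighbouring cells with the value of \<open>w\<close> at their common point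
leaves, on the left cell, the moment of \<open>(s - t\<^sub>k\<^sub>-\<^sub>1) * w'\<close>. This moment dominates both the left moment
and, since \<open>\<rho> \<le> 7/4\<close>, the term \<open>\<rho> * b\<close> inherited from the preceding cell, with one fifth to spare.
The factor 5/2 in \<open>G_his\<close> is five times the factor 1/2 of the Taylor remainders.

On the current cell the choice \<open>\<theta> = \<alpha>/2\<close> makes \<open>s - t_mid t n\<close> orthogonal to \<open>w\<close> on \<open>(t\<^sub>n\<^sub>-\<^sub>1, S)\<close>. Hence
the second-order Taylor term of \<open>v\<close> about the midpoint drops out, and \<open>local_bound\<close> estimates what
remains.

The only analytic difficulty is the singularity of \<open>v\<close> at 0, where just the integral of \<open>s\<^sup>2 * \<bar>v'''\<bar>\<close> is
finite. Taylor expansions are taken from points to the right of it, and the estimates either pass to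
the limit by continuity of \<open>v\<close> or control \<open>v'\<close> by an iterated integral of \<open>\<bar>v'''\<bar>\<close>
(\<open>derivative_remainder_integrable\<close>), which also makes \<open>v'\<close> Lebesgue integrable.

The global estimate follows by exchanging the order of summation and using the identity that defines
the complementary kernels, which are nonnegative because the kernel differences are.
\<close>

section \<open>Integrals over an interval\<close>

text \<open>
Lebesgue integrals over open intervals are turned into gauge integrals over closed ones, where the
fundamental theorem of calculus holds up to an end point at which the derivative is missing.
\<close>

lemma LBINT_eq_integral_of_dominated:
  fixes f g :: "real \<Rightarrow> real"
  assumes "continuous_on {a<..<b} f" "g integrable_on {a..b}" "\<And>x. x \<in> {a<..<b} \<Longrightarrow> \<bar>f x\<bar> \<le> g x"
  shows "set_integrable lborel {a<..<b} f"
    and "(LBINT x:{a<..<b}. f x) = integral {a..b} f"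
proof -
  have "f absolutely_integrable_on {a<..<b}"
    using assms
    by (intro measurable_bounded_by_integrable_imp_absolutely_integrable[where g = g])
       (auto intro: continuous_imp_measurable_on_sets_lebesgue simp flip: integrable_on_Icc_iff_Ioo)
  moreover have "(\<lambda>x. indicator {a<..<b} x *\<^sub>R f x) \<in> borel_measurable lborel"
    using borel_measurable_continuous_on_indicator[OF _ assms(1)] by simp
  ultimately show *: "set_integrable lborel {a<..<b} f"
    unfolding set_integrable_def by (subst (asm) integrable_completion) auto
  show "(LBINT x:{a<..<b}. f x) = integral {a..b} f"
    using set_borel_integral_eq_integral(2)[OF *] by (simp add: integral_open_interval_real)
qed

lemma LBINT_eq_integral_of_continuous:
  fixes f :: "real \<Rightarrow> real"
  assumes "continuous_on {a..b} f"
  shows "(LBINT x:{a<..<b}. f x) = integral {a..b} f"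
proof (rule LBINT_eq_integral_of_dominated(2)[where g = "\<lambda>x. \<bar>f x\<bar>"])
  show "continuous_on {a<..<b} f" "(\<lambda>x. \<bar>f x\<bar>) integrable_on {a..b}"
    using assms by (auto intro!: integrable_continuous_real continuous_on_rabs elim: continuous_on_subset)
qed simp

text \<open>
Monotone convergence towards a singular end point. A bound on the integrals is asked for, not a limit,
because the Taylor formula delivers bounds that are uniform in \<open>r\<close>.
\<close>

lemma integrable_of_bounded_tail_integrals:
  fixes q :: "real \<Rightarrow> real"
  assumes "a < m" "\<And>r. a < r \<Longrightarrow> r \<le> m \<Longrightarrow> q integrable_on {r..m}"
    and nn: "\<And>x. x \<in> {a<..m} \<Longrightarrow> 0 \<le> q x"
    and B: "\<And>r. a < r \<Longrightarrow> r \<le> m \<Longrightarrow> integral {r..m} q \<le> B"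
  shows "q integrable_on {a..m}" and "integral {a..m} q \<le> B"
proof -
  define r where "r k = a + (m - a) / real (Suc k)" for k
  have "(m - a) / real (Suc k) \<le> (m - a) / 1" "(m - a) / real (Suc (Suc k)) \<le> (m - a) / real (Suc k)"
    "0 < (m - a) / real (Suc k)" for k
    using assms(1) by (intro divide_left_mono divide_pos_pos; simp)+
  then have r: "a < r k" "r k \<le> m" "r (Suc k) \<le> r k" for k
    by (simp_all add: r_def algebra_simps)
  have r_lim: "r \<longlonglongrightarrow> a"
    unfolding r_def
    using tendsto_add[OF tendsto_const[of a] tendsto_mult[OF tendsto_const[of "m - a"] LIMSEQ_inverse_real_of_nat]]
    by (simp add: divide_inverse)
  define f where "f k x = (if x \<in> {r k..m} then q x else 0)" for k x
  have f_int: "(f k has_integral integral {r k..m} q) {a<..<m}" for k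
  proof -
    have "(f k has_integral integral {r k..m} q) {a..m}"
      unfolding f_def using r[of k] assms(2)[of "r k"]
      by (subst has_integral_restrict) auto
    then show ?thesis by (simp add: has_integral_Icc_iff_Ioo)
  qed
  have *: "q integrable_on {a<..<m} \<and> (\<lambda>k. integral {a<..<m} (f k)) \<longlonglongrightarrow> integral {a<..<m} q"
  proof (rule monotone_convergence_increasing)
    show "f k integrable_on {a<..<m}" for k using f_int by blast
    show "f k x \<le> f (Suc k) x" if "x \<in> {a<..<m}" for k x
      using that r(3)[of k] nn[of x] by (auto simp: f_def)
    show "(\<lambda>k. f k x) \<longlonglongrightarrow> q x" if "x \<in> {a<..<m}" for x
    proof (rule tendsto_eventually)
      have "\<forall>\<^sub>F k in sequentially. r k < x"
        using r_lim that by (auto intro: order_tendstoD)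
      then show "\<forall>\<^sub>F k in sequentially. f k x = q x"
        by eventually_elim (use that in \<open>auto simp: f_def\<close>)
    qed
    have "\<bar>integral {a<..<m} (f k)\<bar> \<le> B" for k
    proof -
      have "0 \<le> integral {r k..m} q"
        using nn r(1)[of k] by (intro Henstock_Kurzweil_Integration.integral_nonneg assms(2) r) auto
      then show ?thesis
        using integral_unique[OF f_int[of k]] B[OF r(1,2)[of k]] by simp
    qed
    then show "bounded (range (\<lambda>k. integral {a<..<m} (f k)))"
      by (auto simp: bounded_iff)
  qed
  then show "q integrable_on {a..m}" by (simp add: integrable_on_Icc_iff_Ioo)
  have "integral {a<..<m} q \<le> B"
  proof (rule LIMSEQ_le_const2)
    show "(\<lambda>k. integral {a<..<m} (f k)) \<longlonglongrightarrow> integral {a<..<m} q" using * by blast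
    show "\<exists>K. \<forall>k\<ge>K. integral {a<..<m} (f k) \<le> B"
      using integral_unique[OF f_int] B[OF r(1,2)] by simp
  qed
  then show "integral {a..m} q \<le> B" by (simp add: integral_open_interval_real)
qed

section \<open>Taylor expansion next to a singular left end point\<close>

text \<open>
The first three derivatives are carried along as functions, because the one-sided derivatives at an
end point of \<open>S\<close> are not values of \<open>deriv\<close>.
\<close>

definition jet3 :: "real set \<Rightarrow> (real \<Rightarrow> real) \<Rightarrow> (real \<Rightarrow> real) \<Rightarrow> (real \<Rightarrow> real) \<Rightarrow> (real \<Rightarrow> real) \<Rightarrow> bool"
  where "jet3 S v f1 f2 f3 \<longleftrightarrow>
    (\<forall>x\<in>S. (v has_real_derivative f1 x) (at x within S)) \<and>
    (\<forall>x\<in>S. (f1 has_real_derivative f2 x) (at x within S)) \<and>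
    (\<forall>x\<in>S. (f2 has_real_derivative f3 x) (at x within S)) \<and> continuous_on S f3"

lemma jet3_subset: "jet3 S v f1 f2 f3 \<Longrightarrow> R \<subseteq> S \<Longrightarrow> jet3 R v f1 f2 f3"
  unfolding jet3_def by (meson DERIV_subset continuous_on_subset subsetD)

lemma jet3_continuous:
  assumes "jet3 S v f1 f2 f3"
  shows "continuous_on S v" "continuous_on S f1" "continuous_on S f2" "continuous_on S f3"
  using assms unfolding jet3_def by (auto intro: DERIV_continuous_on)

lemma jet3_interior:
  assumes "jet3 S v f1 f2 f3" "open R" "R \<subseteq> S" "x \<in> R"
  shows "(v has_real_derivative f1 x) (at x)" "(f1 has_real_derivative f2 x) (at x)"
    "(f2 has_real_derivative f3 x) (at x)"
proof -
  have "jet3 R v f1 f2 f3" by (rule jet3_subset[OF assms(1,3)])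
  then show "(v has_real_derivative f1 x) (at x)" "(f1 has_real_derivative f2 x) (at x)"
    "(f2 has_real_derivative f3 x) (at x)"
    using assms(4) unfolding jet3_def at_within_open[OF assms(4,2), symmetric] by blast+
qed

text \<open>
The arguments are the centre \<open>c\<close> and the evaluation point \<open>p\<close>. The Taylor formula with integral remainder
is obtained by moving the centre: differentiating in \<open>c\<close> telescopes to the third-order term.
\<close>

definition taylor2 where
  "taylor2 v f1 f2 c p = v c + f1 c * (p - c) + f2 c * (p - c)\<^sup>2 / (2::real)"

lemma taylor2_self [simp]: "taylor2 v f1 f2 c c = v c"
  by (simp add: taylor2_def)

lemma taylor2_has_integral:
  assumes "jet3 {c..d} v f1 f2 f3" "c \<le> d"
  shows "((\<lambda>x. (p - x)\<^sup>2 / 2 * f3 x) has_integral taylor2 v f1 f2 d p - taylor2 v f1 f2 c p) {c..d}"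
proof (rule fundamental_theorem_of_calculus[OF assms(2)])
  fix x assume "x \<in> {c..d}"
  then have "(v has_real_derivative f1 x) (at x within {c..d})"
    "(f1 has_real_derivative f2 x) (at x within {c..d})"
    "(f2 has_real_derivative f3 x) (at x within {c..d})"
    using assms unfolding jet3_def by auto
  then show "((\<lambda>c. taylor2 v f1 f2 c p) has_vector_derivative (p - x)\<^sup>2 / 2 * f3 x) (at x within {c..d})"
    unfolding taylor2_def has_real_derivative_iff_has_vector_derivative [symmetric]
    by (auto intro!: derivative_eq_intros simp: power2_eq_square field_simps)
qed

lemma taylor1_has_integral:
  assumes "jet3 {c..d} v f1 f2 f3" "c \<le> d"
  shows "((\<lambda>x. (p - x) * f3 x) has_integral (f1 d + f2 d * (p - d)) - (f1 c + f2 c * (p - c))) {c..d}"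
proof (rule fundamental_theorem_of_calculus[OF assms(2)])
  fix x assume "x \<in> {c..d}"
  then have 
    "(f1 has_real_derivative f2 x) (at x within {c..d})"
    "(f2 has_real_derivative f3 x) (at x within {c..d})"
    using assms unfolding jet3_def by auto
  then show "((\<lambda>c. f1 c + f2 c * (p - c)) has_vector_derivative (p - x) * f3 x) (at x within {c..d})"
    unfolding has_real_derivative_iff_has_vector_derivative [symmetric]
    by (auto intro!: derivative_eq_intros simp: algebra_simps)
qed

lemma weighted_tail_integral_le:
  fixes f :: "real \<Rightarrow> real"
  assumes "continuous_on {a<..m} f" "(\<lambda>x. (x - a)\<^sup>2 * \<bar>f x\<bar>) integrable_on {a..m}" "a < r" "r \<le> m"
  shows "integral {r..m} (\<lambda>x. (x - r)\<^sup>2 * \<bar>f x\<bar>) \<le> integral {a..m} (\<lambda>x. (x - a)\<^sup>2 * \<bar>f x\<bar>)"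
proof -
  have sub: "(\<lambda>x. (x - a)\<^sup>2 * \<bar>f x\<bar>) integrable_on {r..m}"
    using assms by (intro integrable_subinterval_real[OF assms(2)]) auto
  have "continuous_on {r..m} f"
    using assms by (intro continuous_on_subset[OF assms(1)]) auto
  then have "integral {r..m} (\<lambda>x. (x - r)\<^sup>2 * \<bar>f x\<bar>) \<le> integral {r..m} (\<lambda>x. (x - a)\<^sup>2 * \<bar>f x\<bar>)"
    using assms
    by (intro integral_le sub integrable_continuous_real continuous_intros mult_right_mono power_mono) auto
  also have "\<dots> \<le> integral {a..m} (\<lambda>x. (x - a)\<^sup>2 * \<bar>f x\<bar>)"
    using assms by (intro integral_subset_le sub assms(2)) auto
  finally show ?thesis .
qed

text \<open>
This is Tonelli's theorem for \<open>\<integral>\<^sub>a\<^sup>m \<integral>\<^sub>s\<^sup>m (x - s) * \<bar>f3 x\<bar> dx ds\<close>. It is proved by recognising the threefold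
iterated antiderivative \<open>q0\<close> of \<open>\<bar>f3\<bar>\<close> as a function with a known 3-jet: its Taylor formula about \<open>m\<close>, where
\<open>q0\<close>, \<open>q1\<close> and \<open>q2\<close> vanish, evaluates the integrals from any \<open>r > a\<close>, and \<open>weighted_tail_integral_le\<close>
bounds them uniformly in \<open>r\<close>.
\<close>

lemma derivative_remainder_integrable:
  assumes "a < m" and jet: "jet3 {a<..m} v f1 f2 f3"
    and int: "(\<lambda>x. (x - a)\<^sup>2 * \<bar>f3 x\<bar>) integrable_on {a..m}"
  defines "g \<equiv> \<lambda>s. integral {s..m} (\<lambda>x. (x - s) * \<bar>f3 x\<bar>)"
  shows "g integrable_on {a..m}"
    and "integral {a..m} g \<le> integral {a..m} (\<lambda>x. (x - a)\<^sup>2 * \<bar>f3 x\<bar>) / 2"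
    and "\<And>s. s \<in> {a<..m} \<Longrightarrow> \<bar>f1 s - f1 m - f2 m * (s - m)\<bar> \<le> g s"
proof -
  note f3 = jet3_continuous(4)[OF jet]
  define q2 where "q2 s = integral {s..m} (\<lambda>x. \<bar>f3 x\<bar>)" for s
  define q1 where "q1 s = integral {s..m} q2" for s
  define q0 where "q0 s = integral {s..m} q1" for s
  have qjet: "jet3 {r..m} q0 (\<lambda>s. - q1 s) q2 (\<lambda>s. - \<bar>f3 s\<bar>)" if "a < r" for r
  proof -
    have c3: "continuous_on {r..m} (\<lambda>x. \<bar>f3 x\<bar>)"
      using that by (intro continuous_on_rabs continuous_on_subset[OF f3]) auto
    have d2: "(q2 has_real_derivative - \<bar>f3 x\<bar>) (at x within {r..m})" if "x \<in> {r..m}" for x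
      unfolding q2_def by (rule integral_has_real_derivative'[OF c3 that])
    then have c2: "continuous_on {r..m} q2" by (rule DERIV_continuous_on)
    have d1: "(q1 has_real_derivative - q2 x) (at x within {r..m})" if "x \<in> {r..m}" for x
      unfolding q1_def by (rule integral_has_real_derivative'[OF c2 that])
    then have c1: "continuous_on {r..m} q1" by (rule DERIV_continuous_on)
    have d0: "(q0 has_real_derivative - q1 x) (at x within {r..m})" if "x \<in> {r..m}" for x
      unfolding q0_def by (rule integral_has_real_derivative'[OF c1 that])
    show ?thesis
      unfolding jet3_def using d0 d2 c3 DERIV_minus[OF d1] by (auto intro: continuous_on_minus)
  qed
  have qm: "q0 m = 0" "q1 m = 0" "q2 m = 0" by (simp_all add: q0_def q1_def q2_def)
  have g_q1: "((\<lambda>x. (x - s) * \<bar>f3 x\<bar>) has_integral q1 s) {s..m}" if "a < s" "s \<le> m" for s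
    using taylor1_has_integral[OF qjet[OF that(1)] that(2), of s] qm by (simp add: algebra_simps)
  have g_eq: "g s = q1 s" if "a < s" "s \<le> m" for s
    unfolding g_def using g_q1[OF that] by (rule integral_unique)
  have q0_le: "q0 r \<le> integral {a..m} (\<lambda>x. (x - a)\<^sup>2 * \<bar>f3 x\<bar>) / 2" if "a < r" "r \<le> m" for r
  proof -
    have "((\<lambda>x. - ((r - x)\<^sup>2 / 2 * \<bar>f3 x\<bar>)) has_integral - q0 r) {r..m}"
      using taylor2_has_integral[OF qjet[OF that(1)] that(2), of r] qm
      by (simp add: taylor2_def)
    from has_integral_mult_right[OF this, of "- 2"]
    have "((\<lambda>x. (x - r)\<^sup>2 * \<bar>f3 x\<bar>) has_integral 2 * q0 r) {r..m}"
      by (simp add: power2_commute)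
    then show ?thesis
      using weighted_tail_integral_le[OF f3 int that] by (simp add: integral_unique)
  qed
  have g_int: "g integrable_on {r..m}" if "a < r" "r \<le> m" for r
  proof -
    have "continuous_on {r..m} (\<lambda>s. - (- q1 s))"
      using jet3_continuous(2)[OF qjet[OF that(1)]] by (rule continuous_on_minus)
    then have "q1 integrable_on {r..m}" by (simp add: integrable_continuous_real)
    then show ?thesis
      by (rule integrable_eq) (use g_eq that in auto)
  qed
  have g_le: "integral {r..m} g \<le> integral {a..m} (\<lambda>x. (x - a)\<^sup>2 * \<bar>f3 x\<bar>) / 2" if "a < r" "r \<le> m" for r
  proof -
    have "integral {r..m} g = q0 r"
      unfolding q0_def using that g_eq by (intro Henstock_Kurzweil_Integration.integral_cong) auto
    then show ?thesis using q0_le[OF that] by simp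
  qed
  have g_nonneg: "0 \<le> g s" if "s \<in> {a<..m}" for s
    unfolding g_def using that g_q1[of s]
    by (intro Henstock_Kurzweil_Integration.integral_nonneg) (auto simp: integrable_on_def)
  show "g integrable_on {a..m}" "integral {a..m} g \<le> integral {a..m} (\<lambda>x. (x - a)\<^sup>2 * \<bar>f3 x\<bar>) / 2"
    by (rule integrable_of_bounded_tail_integrals[OF \<open>a < m\<close> g_int g_nonneg g_le]; simp)+
  show "\<bar>f1 s - f1 m - f2 m * (s - m)\<bar> \<le> g s" if "s \<in> {a<..m}" for s
  proof -
    have s: "a < s" "s \<le> m" using that by auto
    have "((\<lambda>x. (s - x) * f3 x) has_integral f1 m + f2 m * (s - m) - f1 s) {s..m}"
    proof -
      have "jet3 {s..m} v f1 f2 f3" using s by (intro jet3_subset[OF jet]) auto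
      from taylor1_has_integral[OF this s(2), of s] show ?thesis by simp
    qed
    moreover have "norm (integral {s..m} (\<lambda>x. (s - x) * f3 x)) \<le> integral {s..m} (\<lambda>x. (x - s) * \<bar>f3 x\<bar>)"
      using calculation g_q1[OF s]
      by (intro integral_norm_bound_integral) (auto simp: integrable_on_def abs_mult)
    ultimately show ?thesis by (simp add: integral_unique g_def abs_minus_commute algebra_simps)
  qed
qed

lemma taylor_remainder_right:
  assumes "jet3 {b..c} v f1 f2 f3" "b \<le> c"
  shows "\<bar>v c - taylor2 v f1 f2 b c\<bar> \<le> integral {b..c} (\<lambda>x. (c - x)\<^sup>2 * \<bar>f3 x\<bar>) / 2"
proof -
  have "(\<lambda>x. (c - x)\<^sup>2 / 2 * \<bar>f3 x\<bar>) integrable_on {b..c}"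
    using jet3_continuous(4)[OF assms(1)] by (intro integrable_continuous_real continuous_intros) auto
  moreover have "((\<lambda>x. (c - x)\<^sup>2 / 2 * f3 x) has_integral v c - taylor2 v f1 f2 b c) {b..c}"
    using taylor2_has_integral[OF assms, of c] by simp
  ultimately have "norm (integral {b..c} (\<lambda>x. (c - x)\<^sup>2 / 2 * f3 x)) \<le> integral {b..c} (\<lambda>x. (c - x)\<^sup>2 / 2 * \<bar>f3 x\<bar>)"
    by (intro integral_norm_bound_integral) (auto simp: abs_mult)
  moreover have "integral {b..c} (\<lambda>x. (c - x)\<^sup>2 / 2 * f3 x) = v c - taylor2 v f1 f2 b c"
    using taylor2_has_integral[OF assms, of c] by (intro integral_unique) simp
  moreover have "integral {b..c} (\<lambda>x. (c - x)\<^sup>2 / 2 * \<bar>f3 x\<bar>) = integral {b..c} (\<lambda>x. (c - x)\<^sup>2 * \<bar>f3 x\<bar>) / 2"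
    by simp
  ultimately show ?thesis unfolding real_norm_def by metis
qed

text \<open>
The remainder estimate at \<open>a\<close> is the limit of the estimates at points \<open>r > a\<close>, whose right-hand sides
are all at most the one at \<open>a\<close>, where the third derivative may fail to be integrable without the weight.
\<close>

lemma taylor_remainder_left:
  assumes "a < b" and jet: "jet3 {a<..b} v f1 f2 f3" and cont: "continuous_on {a..b} v"
    and int: "(\<lambda>x. (x - a)\<^sup>2 * \<bar>f3 x\<bar>) integrable_on {a..b}"
  shows "\<bar>v a - taylor2 v f1 f2 b a\<bar> \<le> integral {a..b} (\<lambda>x. (x - a)\<^sup>2 * \<bar>f3 x\<bar>) / 2"
proof -
  have pos: "0 \<le> integral {a..b} (\<lambda>x. (x - a)\<^sup>2 * \<bar>f3 x\<bar>) / 2 - \<bar>v r - taylor2 v f1 f2 b r\<bar>"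
    if "r \<in> {a<..<b}" for r
  proof -
    have r: "a < r" "r \<le> b" using that by auto
    have cr: "continuous_on {r..b} f3"
      using r by (intro continuous_on_subset[OF jet3_continuous(4)[OF jet]]) auto
    have hi: "((\<lambda>x. (r - x)\<^sup>2 / 2 * f3 x) has_integral taylor2 v f1 f2 b r - v r) {r..b}"
    proof -
      have "jet3 {r..b} v f1 f2 f3" using r by (intro jet3_subset[OF jet]) auto
      from taylor2_has_integral[OF this r(2), of r] show ?thesis by simp
    qed
    then have "norm (integral {r..b} (\<lambda>x. (r - x)\<^sup>2 / 2 * f3 x)) \<le> integral {r..b} (\<lambda>x. ((x - r)\<^sup>2 * \<bar>f3 x\<bar>) / 2)"
      using cr by (intro integral_norm_bound_integral)
        (auto simp: abs_mult power2_commute[of r] intro!: integrable_continuous_real continuous_intros)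
    also have "\<dots> \<le> integral {a..b} (\<lambda>x. (x - a)\<^sup>2 * \<bar>f3 x\<bar>) / 2"
      using weighted_tail_integral_le[OF jet3_continuous(4)[OF jet] int r] by simp
    finally show ?thesis
      unfolding integral_unique[OF hi] by (simp add: abs_minus_commute)
  qed
  have "continuous_on {a..b} (\<lambda>r. integral {a..b} (\<lambda>x. (x - a)\<^sup>2 * \<bar>f3 x\<bar>) / 2 - \<bar>v r - taylor2 v f1 f2 b r\<bar>)"
    unfolding taylor2_def by (intro continuous_intros cont) auto
  then have "0 \<le> integral {a..b} (\<lambda>x. (x - a)\<^sup>2 * \<bar>f3 x\<bar>) / 2 - \<bar>v a - taylor2 v f1 f2 b a\<bar>"
    by (rule continuous_ge_on_Ioo) (use pos \<open>a < b\<close> in simp_all)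
  then show ?thesis by simp
qed

section \<open>The error of quadratic interpolation\<close>

definition quad_interp :: "(real \<Rightarrow> real) \<Rightarrow> real \<Rightarrow> real \<Rightarrow> real \<Rightarrow> real \<Rightarrow> real" where
  "quad_interp v a b c s = v a + (v b - v a) / (b - a) * (s - a)
     + ((v c - v b) / (c - b) - (v b - v a) / (b - a)) / (c - a) * ((s - a) * (s - b))"

text \<open>
Interpolation reproduces the quadratic \<open>p\<close>, so only the deviations \<open>v - p\<close> at the nodes count; the factors
are the Lagrange basis polynomials of \<open>a\<close> and \<open>c\<close>, and the node \<open>b\<close> contributes nothing.
\<close>

lemma quad_interp_error_Lagrange:
  assumes "a < b" "b < c"
    and p: "\<And>x. p x = k0 + k1 * (x - b) + k2 * (x - b)\<^sup>2" and vb: "v b = p b"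
  shows "v s - quad_interp v a b c s =
    (v s - p s) - (b - s) * (c - s) / ((b - a) * (c - a)) * (v a - p a)
      + (s - a) * (b - s) / ((c - b) * (c - a)) * (v c - p c)"
proof -
  obtain va vc where va: "v a = p a + va" and vc: "v c = p c + vc"
    by (metis add_diff_cancel_left' add_diff_eq)
  define h k where "h = b - a" and "k = c - b"
  have hk: "h > 0" "k > 0" "h + k > 0" and a: "a = b - h" and c: "c = b + k" 
    using assms by (auto simp: h_def k_def)
  show ?thesis unfolding quad_interp_def va vc vb p a c
    using hk by (simp add: divide_simps) (simp add: power2_eq_square algebra_simps)
qed

text \<open>
Both squares are nonnegative and at most the right-hand side, hence so is the modulus of their
difference. For the truncated power this uses that \<open>(x - s) / (x - r)\<close> increases with \<open>x\<close>, up to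
\<open>(b - s) / (b - r)\<close> at \<open>x = b\<close>.
\<close>

lemma Peano_kernel_bound:
  fixes a r s b x l :: real
  assumes "a < r" "r < s" "s < b" "x \<in> {r..b}" "0 \<le> l" "l \<le> (b - s) / (b - a)"
  shows "\<bar>l * (x - r)\<^sup>2 - (max 0 (x - s))\<^sup>2\<bar> \<le> (b - s) / (b - r) * (x - a)\<^sup>2"
proof -
  let ?k = "(b - s) / (b - r)"
  have k: "0 \<le> ?k" "l \<le> ?k"
    using assms by (auto intro!: order_trans[OF assms(6)] divide_left_mono)
  have xr: "(x - r)\<^sup>2 \<le> (x - a)\<^sup>2" using assms by (intro power_mono) auto
  have "(max 0 (x - s))\<^sup>2 \<le> ?k * (x - r)\<^sup>2"
  proof (cases "x \<le> s")
    case False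
    have "(b - s) * (x - r) - (x - s) * (b - r) = (s - r) * (b - x)" by (simp add: algebra_simps)
    moreover have "0 \<le> (s - r) * (b - x)" using assms by (intro mult_nonneg_nonneg) auto
    ultimately have "(x - s) * (b - r) \<le> (b - s) * (x - r)" by linarith
    then have "x - s \<le> ?k * (x - r)" using assms by (simp add: field_simps)
    then have "(x - s) * (x - s) \<le> (?k * (x - r)) * (x - r)"
      using False assms k(1) by (intro mult_mono) auto
    then show ?thesis using False by (simp add: power2_eq_square mult.assoc)
  next
    case True
    have "0 \<le> ?k * (x - r)\<^sup>2" using k by (intro mult_nonneg_nonneg) auto
    then show ?thesis using True by simp
  qed
  also have "\<dots> \<le> ?k * (x - a)\<^sup>2" using k xr by (intro mult_left_mono)
  finally have "(max 0 (x - s))\<^sup>2 \<le> ?k * (x - a)\<^sup>2" .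
  moreover have "l * (x - r)\<^sup>2 \<le> ?k * (x - a)\<^sup>2" using k xr assms(5) by (intro mult_mono) auto
  moreover have "0 \<le> l * (x - r)\<^sup>2" using assms(5) by simp
  ultimately show ?thesis
    using zero_le_power2[of "max 0 (x - s)"] by (simp only: abs_le_iff) linarith
qed

text \<open>
Expanding \<open>v\<close> about the middle node \<open>b\<close> separates the two integrals: the Taylor remainder at \<open>c\<close> depends on
the third derivative on \<open>[b, c]\<close> only, those at \<open>a\<close> and \<open>s\<close> on that on \<open>[a, b]\<close> only. The point \<open>a\<close>
is again approached by points \<open>r > a\<close>.
\<close>

lemma quad_interp_error_bound:
  assumes abc: "a < b" "b < c" and jet: "jet3 {a<..c} v f1 f2 f3" and cont: "continuous_on {a..c} v"
    and int: "(\<lambda>x. (x - a)\<^sup>2 * \<bar>f3 x\<bar>) integrable_on {a..b}" and s: "s \<in> {a<..<b}"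
  shows "\<bar>v s - quad_interp v a b c s\<bar>
    \<le> (b - s) / (b - a) * (integral {a..b} (\<lambda>x. (x - a)\<^sup>2 * \<bar>f3 x\<bar>) / 2)
      + (s - a) * (b - s) / ((c - b) * (c - a)) * (integral {b..c} (\<lambda>x. (c - x)\<^sup>2 * \<bar>f3 x\<bar>) / 2)"
proof -
  let ?H = "integral {a..b} (\<lambda>x. (x - a)\<^sup>2 * \<bar>f3 x\<bar>)"
  define u where "u p = v p - taylor2 v f1 f2 b p" for p
  define l where "l = (b - s) * (c - s) / ((b - a) * (c - a))"
  have l: "0 \<le> l" "l \<le> (b - s) / (b - a)"
  proof -
    have "(c - s) / (c - a) \<le> 1" using s abc by simp
    then have "(b - s) / (b - a) * ((c - s) / (c - a)) \<le> (b - s) / (b - a) * 1"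
      using s abc by (intro mult_left_mono) auto
    then show "l \<le> (b - s) / (b - a)" by (simp add: l_def)
  qed (use s abc in \<open>auto simp: l_def\<close>)
  have left: "0 \<le> (b - s) / (b - r) * (?H / 2) - \<bar>u s - l * u r\<bar>" if "r \<in> {a<..<s}" for r
  proof -
    have r: "a < r" "r < s" "r \<le> s" "s < b" "s \<le> b" "r \<le> b" using that s by auto
    have jr: "jet3 {r..b} v f1 f2 f3" "jet3 {s..b} v f1 f2 f3"
      using r abc by (intro jet3_subset[OF jet]; simp add: subset_iff)+
    \<comment> \<open>With the truncated power the remainder at \<open>s\<close> becomes an integral over the same interval as the one at \<open>r\<close>.\<close>
    have "((\<lambda>x. (max 0 (x - s))\<^sup>2 / 2 * f3 x) has_integral 0) {r..s}"
      by (rule has_integral_eq[where f = "\<lambda>x. 0"]) auto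
    moreover have "((\<lambda>x. (s - x)\<^sup>2 / 2 * f3 x) has_integral - u s) {s..b}"
      using taylor2_has_integral[OF jr(2) r(5), of s] by (simp add: u_def)
    then have "((\<lambda>x. (max 0 (x - s))\<^sup>2 / 2 * f3 x) has_integral - u s) {s..b}"
      by (rule has_integral_eq[rotated]) (auto simp: power2_commute[of s])
    ultimately have "((\<lambda>x. (max 0 (x - s))\<^sup>2 / 2 * f3 x) has_integral - u s) {r..b}"
      by (auto dest: has_integral_combine[OF r(3,5)])
    moreover have "((\<lambda>x. l * ((r - x)\<^sup>2 / 2 * f3 x)) has_integral l * (- u r)) {r..b}"
      using has_integral_mult_right[OF taylor2_has_integral[OF jr(1) r(6), of r], of l]
      by (simp add: u_def)
    ultimately have hi: "((\<lambda>x. l * ((r - x)\<^sup>2 / 2 * f3 x) - (max 0 (x - s))\<^sup>2 / 2 * f3 x) has_integral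
        l * (- u r) - (- u s)) {r..b}"
      by (intro has_integral_diff)
    have sub: "(\<lambda>x. (x - a)\<^sup>2 * \<bar>f3 x\<bar>) integrable_on {r..b}"
      using r by (intro integrable_subinterval_real[OF int]) auto
    have "norm (integral {r..b} (\<lambda>x. l * ((r - x)\<^sup>2 / 2 * f3 x) - (max 0 (x - s))\<^sup>2 / 2 * f3 x))
        \<le> integral {r..b} (\<lambda>x. (b - s) / (b - r) / 2 * ((x - a)\<^sup>2 * \<bar>f3 x\<bar>))"
    proof (rule integral_norm_bound_integral)
      fix x assume x: "x \<in> {r..b}"
      have "l * ((r - x)\<^sup>2 / 2 * f3 x) - (max 0 (x - s))\<^sup>2 / 2 * f3 x
          = (l * (x - r)\<^sup>2 - (max 0 (x - s))\<^sup>2) * (f3 x / 2)"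
        by (simp add: power2_commute[of r] algebra_simps)
      also have "norm \<dots> \<le> ((b - s) / (b - r) * (x - a)\<^sup>2) * \<bar>f3 x / 2\<bar>"
        unfolding real_norm_def abs_mult[of "l * _ - _"]
        by (intro mult_right_mono Peano_kernel_bound r x l) auto
      finally show "norm (l * ((r - x)\<^sup>2 / 2 * f3 x) - (max 0 (x - s))\<^sup>2 / 2 * f3 x)
          \<le> (b - s) / (b - r) / 2 * ((x - a)\<^sup>2 * \<bar>f3 x\<bar>)"
        by (simp add: abs_mult mult_ac)
    next
      show "(\<lambda>x. (b - s) / (b - r) / 2 * ((x - a)\<^sup>2 * \<bar>f3 x\<bar>)) integrable_on {r..b}"
        using integrable_cmul[OF sub, of "(b - s) / (b - r) / 2"] by simp
    qed (use hi in blast)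
    also have "\<dots> = (b - s) / (b - r) / 2 * integral {r..b} (\<lambda>x. (x - a)\<^sup>2 * \<bar>f3 x\<bar>)" by simp
    also have "\<dots> \<le> (b - s) / (b - r) / 2 * ?H"
      using r by (intro mult_left_mono integral_subset_le sub int) auto
    finally show ?thesis using integral_unique[OF hi] by (simp add: algebra_simps)
  qed
  have cont': "continuous_on {a..s} v" using s abc by (intro continuous_on_subset[OF cont]) auto
  have "continuous_on {a..s} (\<lambda>r. (b - s) / (b - r) * (?H / 2) - \<bar>u s - l * u r\<bar>)"
    unfolding u_def taylor2_def using s by (intro continuous_intros cont') auto
  then have e1: "0 \<le> (b - s) / (b - a) * (?H / 2) - \<bar>u s - l * u a\<bar>"
    by (rule continuous_ge_on_Ioo) (use s left in simp_all)
  have "\<bar>u c\<bar> \<le> integral {b..c} (\<lambda>x. (c - x)\<^sup>2 * \<bar>f3 x\<bar>) / 2"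
    unfolding u_def using abc by (intro taylor_remainder_right jet3_subset[OF jet]) auto
  then have e2: "(s - a) * (b - s) / ((c - b) * (c - a)) * \<bar>u c\<bar>
      \<le> (s - a) * (b - s) / ((c - b) * (c - a)) * (integral {b..c} (\<lambda>x. (c - x)\<^sup>2 * \<bar>f3 x\<bar>) / 2)"
    using s abc by (intro mult_left_mono) auto
  have e3: "v s - quad_interp v a b c s = (u s - l * u a) + (s - a) * (b - s) / ((c - b) * (c - a)) * u c"
    unfolding u_def l_def
    by (rule quad_interp_error_Lagrange[OF abc, of _ "v b" "f1 b" "f2 b / 2"]) (auto simp: taylor2_def)
  have e4: "\<bar>(s - a) * (b - s) / ((c - b) * (c - a)) * u c\<bar> = (s - a) * (b - s) / ((c - b) * (c - a)) * \<bar>u c\<bar>"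
    using s abc by (simp add: abs_mult)
  have "\<bar>E\<bar> \<le> A + B" if "0 \<le> A - \<bar>X\<bar>" "\<bar>Y\<bar> \<le> B" "E = X + Y" for A B E X Y :: real
    using that by linarith
  from this[OF e1 e2[folded e4] e3] show ?thesis .
qed

section \<open>Moments of a convex increasing kernel\<close>

lemma has_integral_by_parts_derivative:
  fixes F :: "real \<Rightarrow> real"
  assumes "a \<le> b" "continuous_on {a..b} F"
    and "\<And>x. x \<in> {a<..<b} \<Longrightarrow> (F has_real_derivative g x + h x) (at x)"
    and "g integrable_on {a..b}"
  shows "(h has_integral F b - F a - integral {a..b} g) {a..b}"
proof -
  have "((\<lambda>x. g x + h x) has_integral F b - F a) {a..b}"
    using assms by (intro fundamental_theorem_of_calculus_interior)
      (auto simp flip: has_real_derivative_iff_has_vector_derivative)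
  from has_integral_diff[OF this integrable_integral[OF assms(4)]] show ?thesis by simp
qed

lemma has_integral_of_derivative:
  fixes F :: "real \<Rightarrow> real"
  assumes "a \<le> b" "\<And>x. (F has_real_derivative f x) (at x)"
  shows "(f has_integral F b - F a) {a..b}"
  using assms fundamental_theorem_of_calculus[of a b F f]
  by (metis has_real_derivative_iff_has_vector_derivative has_vector_derivative_at_within)

text \<open>
The kernel \<open>w\<close> may be singular at \<open>S\<close>. Up to there it is increasing and convex; on the past cells the
comparison of the discrete kernels rests on these two properties.
\<close>

locale convex_kernel =
  fixes S :: real and w w1 :: "real \<Rightarrow> real"
  assumes w_deriv: "x < S \<Longrightarrow> (w has_real_derivative w1 x) (at x)"
    and w1_cont: "continuous_on {..<S} w1"
    and w1_nonneg: "x < S \<Longrightarrow> 0 \<le> w1 x"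
    and w1_mono: "x \<le> y \<Longrightarrow> y < S \<Longrightarrow> w1 x \<le> w1 y"
begin

lemma w_mono: "x \<le> y \<Longrightarrow> y < S \<Longrightarrow> w x \<le> w y"
  by (rule DERIV_nonneg_imp_nondecreasing[where f = w])
     (meson w_deriv w1_nonneg order.strict_trans1)+

lemma continuous_w: "b < S \<Longrightarrow> continuous_on {a..b} w"
  by (intro continuous_at_imp_continuous_on ballI DERIV_isCont[OF w_deriv]) auto

lemma continuous_w1: "b < S \<Longrightarrow> continuous_on {a..b} w1"
  by (rule continuous_on_subset[OF w1_cont]) auto

lemma integrable_w: "b < S \<Longrightarrow> w integrable_on {a..b}"
  by (intro integrable_continuous_real continuous_w)

text \<open>
The next three lemmas are integrations by parts. They relate the averages of \<open>w\<close> that occur in the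
coefficients of the formula to integrals of its derivative against nonnegative weights.
\<close>

lemma moment_left:
  assumes "a \<le> b" "b < S"
  shows "((\<lambda>s. (b - s) * w1 s) has_integral integral {a..b} w - (b - a) * w a) {a..b}"
proof -
  have "((\<lambda>s. (b - s) * w1 s) has_integral (b - b) * w b - (b - a) * w a - integral {a..b} (\<lambda>s. - w s)) {a..b}"
    using assms w_deriv
    by (intro has_integral_by_parts_derivative[where F = "\<lambda>s. (b - s) * w s"] continuous_intros
          continuous_w integrable_neg integrable_w)
       (auto intro!: derivative_eq_intros)
  then show ?thesis by simp
qed

lemma moment_right:
  assumes "a \<le> b" "b < S"
  shows "((\<lambda>s. (s - a) * w1 s) has_integral (b - a) * w b - integral {a..b} w) {a..b}"
proof -
  have "((\<lambda>s. (s - a) * w1 s) has_integral (b - a) * w b - (a - a) * w a - integral {a..b} w) {a..b}"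
    using assms w_deriv
    by (intro has_integral_by_parts_derivative[where F = "\<lambda>s. (s - a) * w s"] continuous_intros
          continuous_w integrable_w)
       (auto intro!: derivative_eq_intros)
  then show ?thesis by simp
qed

lemma moment_bubble:
  assumes "a \<le> b" "b < S"
  shows "((\<lambda>s. (s - a) * (b - s) * w1 s) has_integral 2 * integral {a..b} (\<lambda>s. (s - (a + b) / 2) * w s)) {a..b}"
proof -
  have "((\<lambda>s. (s - a) * (b - s) * w1 s) has_integral (b - a) * (b - b) * w b - (a - a) * (b - a) * w a
      - integral {a..b} (\<lambda>s. - 2 * ((s - (a + b) / 2) * w s))) {a..b}"
  proof (rule has_integral_by_parts_derivative[where F = "\<lambda>s. (s - a) * (b - s) * w s"])
    fix x assume "x \<in> {a<..<b}"
    then have "(w has_real_derivative w1 x) (at x)" using assms w_deriv by auto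
    then show "((\<lambda>s. (s - a) * (b - s) * w s) has_real_derivative
        - 2 * ((x - (a + b) / 2) * w x) + (x - a) * (b - x) * w1 x) (at x)"
      by (auto intro!: derivative_eq_intros simp: field_simps)
  qed (use assms in \<open>auto intro!: continuous_intros continuous_w integrable_continuous_real\<close>)
  then show ?thesis by simp
qed

lemma bubble_nonneg:
  assumes "a \<le> b" "b < S"
  shows "0 \<le> integral {a..b} (\<lambda>s. (s - a) * (b - s) * w1 s)"
  using assms moment_bubble[OF assms] w1_nonneg
  by (intro Henstock_Kurzweil_Integration.integral_nonneg) (auto simp: integrable_on_def)

lemma bubble_le_left:
  assumes "a \<le> b" "b < S"
  shows "integral {a..b} (\<lambda>s. (s - a) * (b - s) * w1 s) \<le> (b - a) * integral {a..b} (\<lambda>s. (b - s) * w1 s)"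
proof -
  have "integral {a..b} (\<lambda>s. (s - a) * (b - s) * w1 s) \<le> integral {a..b} (\<lambda>s. (b - a) * ((b - s) * w1 s))"
    using assms w1_nonneg
    by (intro integral_le integrable_continuous_real continuous_intros continuous_w1)
       (auto simp: mult.assoc intro!: mult_right_mono)
  then show ?thesis by simp
qed

text \<open>
The constant 1/6 is the integral of \<open>x * (1 - x)\<close> over the unit interval.
\<close>

lemma bubble_le_endpoint:
  assumes "a \<le> b" "b < S"
  shows "integral {a..b} (\<lambda>s. (s - a) * (b - s) * w1 s) \<le> (b - a) ^ 3 / 6 * w1 b"
proof -
  have "((\<lambda>s. (s - a) * (b - s) * w1 b) has_integral
      ((b + a) * b\<^sup>2 / 2 - b ^ 3 / 3 - a * b * b) * w1 b - ((b + a) * a\<^sup>2 / 2 - a ^ 3 / 3 - a * b * a) * w1 b) {a..b}"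
    by (rule has_integral_of_derivative[OF assms(1)])
       (auto intro!: derivative_eq_intros simp: algebra_simps power2_eq_square)
  moreover have "((b + a) * b\<^sup>2 / 2 - b ^ 3 / 3 - a * b * b) * w1 b - ((b + a) * a\<^sup>2 / 2 - a ^ 3 / 3 - a * b * a) * w1 b
      = (b - a) ^ 3 / 6 * w1 b"
    by (simp add: field_simps power2_eq_square power3_eq_cube)
  ultimately have "integral {a..b} (\<lambda>s. (s - a) * (b - s) * w1 b) = (b - a) ^ 3 / 6 * w1 b"
    using integral_unique by metis
  moreover have "integral {a..b} (\<lambda>s. (s - a) * (b - s) * w1 s) \<le> integral {a..b} (\<lambda>s. (s - a) * (b - s) * w1 b)"
    using assms w1_mono
    by (intro integral_le integrable_continuous_real continuous_intros continuous_w1)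
       (auto intro!: mult_left_mono)
  ultimately show ?thesis by metis
qed

text \<open>
Chebyshev's inequality: \<open>w1\<close> increases and the difference of the weights, \<open>2 * (s - m)\<close> with \<open>m\<close> the
midpoint, has mean zero and the sign of \<open>s - m\<close>.
\<close>

lemma left_le_right:
  assumes "a \<le> b" "b < S"
  shows "integral {a..b} (\<lambda>s. (b - s) * w1 s) \<le> integral {a..b} (\<lambda>s. (s - a) * w1 s)"
proof -
  let ?m = "(a + b) / 2"
  have hi: "((\<lambda>s. 2 * (s - ?m) * w1 ?m) has_integral (b - ?m)\<^sup>2 * w1 ?m - (a - ?m)\<^sup>2 * w1 ?m) {a..b}"
    by (rule has_integral_of_derivative[OF assms(1)])
       (auto intro!: derivative_eq_intros simp: field_simps)
  have "(b - ?m)\<^sup>2 = (a - ?m)\<^sup>2" by (simp add: power2_eq_square field_simps)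
  then have "0 = integral {a..b} (\<lambda>s. 2 * (s - ?m) * w1 ?m)"
    unfolding integral_unique[OF hi] by simp
  also have "\<dots> \<le> integral {a..b} (\<lambda>s. 2 * (s - ?m) * w1 s)"
  proof (rule integral_le)
    fix s assume s: "s \<in> {a..b}"
    show "2 * (s - ?m) * w1 ?m \<le> 2 * (s - ?m) * w1 s"
    proof (cases "?m \<le> s")
      case True
      then show ?thesis using s assms w1_mono[of ?m s] by (intro mult_left_mono) auto
    next
      case False
      then show ?thesis using s assms w1_mono[of s ?m] by (intro mult_left_mono_neg) auto
    qed
  qed (use assms in \<open>auto intro!: continuous_intros continuous_w1 integrable_continuous_real\<close>)
  also have "\<dots> = integral {a..b} (\<lambda>s. (s - a) * w1 s - (b - s) * w1 s)"
    by (rule Henstock_Kurzweil_Integration.integral_cong) (simp add: field_simps)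
  also have "\<dots> = integral {a..b} (\<lambda>s. (s - a) * w1 s) - integral {a..b} (\<lambda>s. (b - s) * w1 s)"
    using moment_left[OF assms] moment_right[OF assms]
    by (intro Henstock_Kurzweil_Integration.integral_diff) (auto simp: integrable_on_def)
  finally show ?thesis by simp
qed

lemma right_ge_endpoint:
  assumes "a \<le> b" "b < S"
  shows "(b - a)\<^sup>2 / 2 * w1 a \<le> integral {a..b} (\<lambda>s. (s - a) * w1 s)"
proof -
  have hi: "((\<lambda>s. (s - a) * w1 a) has_integral (b - a)\<^sup>2 / 2 * w1 a - (a - a)\<^sup>2 / 2 * w1 a) {a..b}"
    by (rule has_integral_of_derivative[OF assms(1)])
       (auto intro!: derivative_eq_intros simp: field_simps)
  have "integral {a..b} (\<lambda>s. (s - a) * w1 a) \<le> integral {a..b} (\<lambda>s. (s - a) * w1 s)"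
    using assms w1_mono
    by (intro integral_le integrable_continuous_real continuous_intros continuous_w1)
       (auto intro!: mult_left_mono)
  then show ?thesis unfolding integral_unique[OF hi] by simp
qed

end

text \<open>
The factor \<open>2 * (s - (a + b) / 2)\<close> is the derivative of \<open>(s - a) * (s - b)\<close>, written so that its integral
against the kernel is visibly the one in \<open>coeff_b\<close>.
\<close>

definition quad_interp_deriv :: "(real \<Rightarrow> real) \<Rightarrow> real \<Rightarrow> real \<Rightarrow> real \<Rightarrow> real \<Rightarrow> real" where
  "quad_interp_deriv v a b c s = (v b - v a) / (b - a)
     + ((v c - v b) / (c - b) - (v b - v a) / (b - a)) / (c - a) * (2 * (s - (a + b) / 2))"

lemma quad_interp_has_derivative:
  "(quad_interp v a b c has_real_derivative quad_interp_deriv v a b c s) (at s)"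
proof -
  have "((\<lambda>s. p + q * (s - a) + r * ((s - a) * (s - b))) has_real_derivative q + r * (2 * (s - (a + b) / 2))) (at s)"
    for p q r
    by (rule derivative_eq_intros refl)+ (simp add: algebra_simps)
  then show ?thesis unfolding quad_interp_def [abs_def] quad_interp_deriv_def .
qed

lemma continuous_on_quad_interp [continuous_intros]: "continuous_on A (quad_interp v a b c)"
  by (intro continuous_at_imp_continuous_on ballI DERIV_isCont[OF quad_interp_has_derivative])

lemma quad_interp_nodes:
  assumes "a < b"
  shows "quad_interp v a b c a = v a" "quad_interp v a b c b = v b"
  using assms by (simp_all add: quad_interp_def)

context convex_kernel
begin

text \<open>
The boundary terms vanish because the interpolation error is zero at \<open>a\<close> and \<open>b\<close>. At \<open>a\<close> continuity of \<open>v\<close>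
stands in for differentiability, which covers the first cell, where \<open>f1\<close> may blow up.
\<close>

lemma history_integral:
  assumes abc: "a < b" "b < c" "b < S" and jet: "jet3 {a<..c} v f1 f2 f3" and cont: "continuous_on {a..c} v"
  shows "((\<lambda>s. w s * (f1 s - quad_interp_deriv v a b c s)) has_integral
    - integral {a..b} (\<lambda>s. w1 s * (v s - quad_interp v a b c s))) {a..b}"
proof -
  have cv: "continuous_on {a..b} v" using abc by (intro continuous_on_subset[OF cont]) auto
  have "((\<lambda>s. w s * (f1 s - quad_interp_deriv v a b c s)) has_integral
      w b * (v b - quad_interp v a b c b) - w a * (v a - quad_interp v a b c a)
        - integral {a..b} (\<lambda>s. w1 s * (v s - quad_interp v a b c s))) {a..b}"
  proof (rule has_integral_by_parts_derivative[where F = "\<lambda>s. w s * (v s - quad_interp v a b c s)"])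
    fix x assume x: "x \<in> {a<..<b}"
    have "(v has_real_derivative f1 x) (at x)"
      by (rule jet3_interior(1)[OF jet open_greaterThanLessThan[of a c]]) (use x abc in auto)
    moreover have "(w has_real_derivative w1 x) (at x)" using x abc by (intro w_deriv) auto
    ultimately show "((\<lambda>s. w s * (v s - quad_interp v a b c s)) has_real_derivative
        w1 x * (v x - quad_interp v a b c x) + w x * (f1 x - quad_interp_deriv v a b c x)) (at x)"
      by (auto intro!: derivative_eq_intros quad_interp_has_derivative simp: algebra_simps)
  qed (use abc in \<open>auto intro!: continuous_intros continuous_w continuous_w1 cv integrable_continuous_real\<close>)
  then show ?thesis using abc by (simp add: quad_interp_nodes)
qed

lemma history_bound:
  assumes abc: "a < b" "b < c" "b < S" and jet: "jet3 {a<..c} v f1 f2 f3" and cont: "continuous_on {a..c} v"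
    and int: "(\<lambda>x. (x - a)\<^sup>2 * \<bar>f3 x\<bar>) integrable_on {a..b}"
  shows "\<bar>integral {a..b} (\<lambda>s. w s * (f1 s - quad_interp_deriv v a b c s))\<bar>
    \<le> integral {a..b} (\<lambda>s. (b - s) * w1 s) / (b - a) * (integral {a..b} (\<lambda>x. (x - a)\<^sup>2 * \<bar>f3 x\<bar>) / 2)
     + integral {a..b} (\<lambda>s. (s - a) * (b - s) * w1 s) / ((c - b) * (c - a)) * (integral {b..c} (\<lambda>x. (c - x)\<^sup>2 * \<bar>f3 x\<bar>) / 2)"
proof -
  define H1 H2 where "H1 = integral {a..b} (\<lambda>x. (x - a)\<^sup>2 * \<bar>f3 x\<bar>) / 2"
    and "H2 = integral {b..c} (\<lambda>x. (c - x)\<^sup>2 * \<bar>f3 x\<bar>) / 2"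
  have f3c: "continuous_on {b..c} f3"
    using abc by (intro continuous_on_subset[OF jet3_continuous(4)[OF jet]]) auto
  have H: "0 \<le> H1" "0 \<le> H2" unfolding H1_def H2_def using int
    by (auto intro!: divide_nonneg_pos Henstock_Kurzweil_Integration.integral_nonneg integrable_continuous_real continuous_intros f3c)
  have cv: "continuous_on {a..b} v" using abc by (intro continuous_on_subset[OF cont]) auto
  let ?e = "\<lambda>s. w1 s * (v s - quad_interp v a b c s)"
  let ?B = "\<lambda>s. (b - s) * w1 s * (H1 / (b - a)) + (s - a) * (b - s) * w1 s * (H2 / ((c - b) * (c - a)))"
  have hiB: "(?B has_integral integral {a..b} (\<lambda>s. (b - s) * w1 s) * (H1 / (b - a))
      + integral {a..b} (\<lambda>s. (s - a) * (b - s) * w1 s) * (H2 / ((c - b) * (c - a)))) {a..b}"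
    using moment_left[of a b] moment_bubble[of a b] abc
    by (intro has_integral_add has_integral_mult_left integrable_integral) (auto simp: integrable_on_def)
  have "norm (integral {a..b} ?e) \<le> integral {a..b} ?B"
  proof (rule integral_norm_bound_integral)
    show "?e integrable_on {a..b}"
      using abc by (intro integrable_continuous_real continuous_intros continuous_w1 cv)
    show "?B integrable_on {a..b}" using hiB by blast
    fix s assume s: "s \<in> {a..b}"
    have w1s: "0 \<le> w1 s" using s abc by (intro w1_nonneg) auto
    have "\<bar>v s - quad_interp v a b c s\<bar> \<le> (b - s) / (b - a) * H1 + (s - a) * (b - s) / ((c - b) * (c - a)) * H2"
    proof (cases "s = a \<or> s = b")
      case True
      then show ?thesis using abc H s by (auto simp: quad_interp_nodes)
    next
      case False
      then show ?thesis unfolding H1_def H2_def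
        using s by (intro quad_interp_error_bound[OF abc(1,2) jet cont int]) auto
    qed
    then have "w1 s * \<bar>v s - quad_interp v a b c s\<bar> \<le> w1 s * ((b - s) / (b - a) * H1 + (s - a) * (b - s) / ((c - b) * (c - a)) * H2)"
      using w1s by (rule mult_left_mono)
    also have "\<dots> = ?B s" by (simp add: distrib_left mult_ac)
    finally show "norm (?e s) \<le> ?B s" using w1s by (simp add: abs_mult)
  qed
  then show ?thesis
    using integral_unique[OF hiB] integral_unique[OF history_integral[OF abc jet cont]]
    unfolding H1_def[symmetric] H2_def[symmetric] by simp
qed

end

section \<open>Error integrals against a convex kernel\<close>

context convex_kernel
begin

text \<open>
The two singularities are separated by \<open>y\<close>: to its left the kernel is bounded and the derivative is
dominated by an integrable function, to its right the roles are exchanged.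
\<close>

lemma weighted_derivative_set_integrable:
  assumes ay: "a < y" "y < S" "S \<le> c" and jet: "jet3 {a<..c} v f1 f2 f3"
    and int: "(\<lambda>x. (x - a)\<^sup>2 * \<bar>f3 x\<bar>) integrable_on {a..y}"
    and wS: "w integrable_on {a..S}" and w0: "\<And>s. s \<le> S \<Longrightarrow> 0 \<le> w s"
  shows "set_integrable lborel {a<..<S} (\<lambda>s. w s * f1 s)"
proof -
  define g where "g s = integral {s..y} (\<lambda>x. (x - s) * \<bar>f3 x\<bar>)" for s
  have jy: "jet3 {a<..y} v f1 f2 f3" using ay by (intro jet3_subset[OF jet]) auto
  note g = derivative_remainder_integrable[OF ay(1) jy int, folded g_def]
  \<comment> \<open>On the left part, \<open>\<bar>f1 x\<bar> \<le> g x + C1\<close>; on the right part, \<open>\<bar>f1 x\<bar> \<le> C\<close> by compactness.\<close>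
  define C1 where "C1 = \<bar>f1 y\<bar> + \<bar>f2 y\<bar> * (y - a)"
  have "continuous_on {y..c} f1"
    using ay by (intro continuous_on_subset[OF jet3_continuous(2)[OF jet]]) auto
  then have "bounded (f1 ` {y..c})"
    by (intro compact_imp_bounded compact_continuous_image) auto
  then obtain C where C: "\<And>x. x \<in> {y..c} \<Longrightarrow> \<bar>f1 x\<bar> \<le> C"
    unfolding bounded_iff by (metis imageI real_norm_def)
  from C[of y] have C0: "0 \<le> C" using ay by simp
  define G where "G x = (if x \<in> {a..y} then w y * (g x + C1) else 0) + C * w x" for x
  show ?thesis
  proof (rule LBINT_eq_integral_of_dominated(1))
    have "continuous_on {a<..<S} w"
      by (intro continuous_at_imp_continuous_on ballI DERIV_isCont[OF w_deriv]) auto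
    moreover have "continuous_on {a<..<S} f1"
      using ay by (intro continuous_on_subset[OF jet3_continuous(2)[OF jet]]) auto
    ultimately show "continuous_on {a<..<S} (\<lambda>s. w s * f1 s)" by (rule continuous_on_mult)
    have "(\<lambda>x. g x + C1) integrable_on {a..y}"
      using g(1) by (intro integrable_add) auto
    then have "(\<lambda>x. w y * (g x + C1)) integrable_on {a..y}"
      using integrable_cmul[of "\<lambda>x. g x + C1" "{a..y}" "w y"] by simp
    then have "(\<lambda>x. if x \<in> {a..y} then w y * (g x + C1) else 0) integrable_on {a..S}"
      using ay unfolding integrable_on_def by (subst has_integral_restrict) auto
    moreover have "(\<lambda>x. C * w x) integrable_on {a..S}"
      using integrable_cmul[OF wS, of C] by simp
    ultimately show "G integrable_on {a..S}" unfolding G_def by (rule integrable_add)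
  next
    fix x assume x: "x \<in> {a<..<S}"
    have w: "0 \<le> w x" using x by (intro w0) auto
    show "\<bar>w x * f1 x\<bar> \<le> G x"
    proof (cases "x \<le> y")
      case True
      have "\<bar>f2 y * (x - y)\<bar> \<le> \<bar>f2 y\<bar> * (y - a)"
        using True x by (simp add: abs_mult mult_left_mono)
      then have "\<bar>f1 x\<bar> \<le> g x + C1"
        using g(3)[of x] True x unfolding C1_def by auto
      then have "w x * \<bar>f1 x\<bar> \<le> w y * (g x + C1)"
        using True x ay w w0[of y] by (intro mult_mono w_mono) auto
      then show ?thesis using True x w C0 by (simp add: G_def abs_mult add_increasing2)
    next
      case False
      then have "w x * \<bar>f1 x\<bar> \<le> w x * C" using x ay w by (intro mult_left_mono C) auto
      then show ?thesis using False w by (simp add: G_def abs_mult mult.commute)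
    qed
  qed
qed

text \<open>
Let \<open>h\<close> and \<open>H\<close> be the two integrals on the right-hand side, and \<open>r\<close> the remainder of \<open>f1\<close> after its
linear Taylor polynomial \<open>f1 m + f2 m * (s - m)\<close> about the midpoint. The linear term is annihilated by
\<open>orth\<close>. The integral of \<open>w * r\<close> over \<open>[a, m]\<close> costs \<open>w m * h / 2\<close>, which is why \<open>wm\<close> is assumed; over
\<open>[m, S]\<close> it costs \<open>H\<close> times the integral of \<open>w\<close>, because \<open>r\<close> is bounded by \<open>H\<close> there, however singular \<open>w\<close>
is at \<open>S\<close>. The difference quotient adds the Taylor remainders of \<open>v\<close> at the two end points.
\<close>

lemma local_bound:
  assumes "a < b" and m: "m = (a + b) / 2" and S: "m < S" "S \<le> b"
    and jet: "jet3 {a<..b} v f1 f2 f3" and cont: "continuous_on {a..b} v"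
    and int: "(\<lambda>x. (x - a)\<^sup>2 * \<bar>f3 x\<bar>) integrable_on {a..m}"
    and wS: "w integrable_on {a..S}" and w0: "\<And>s. s \<le> S \<Longrightarrow> 0 \<le> w s"
    and orth: "((\<lambda>s. (s - m) * w s) has_integral 0) {a..S}"
    and wm: "w m \<le> 2 * (integral {a..S} w / (b - a))"
    and wf: "(\<lambda>s. w s * f1 s) integrable_on {a..S}"
  shows "\<bar>integral {a..S} (\<lambda>s. w s * f1 s) - integral {a..S} w / (b - a) * (v b - v a)\<bar>
    \<le> integral {a..S} w / (b - a) * (3 / 2 * integral {a..m} (\<lambda>x. (x - a)\<^sup>2 * \<bar>f3 x\<bar>)
        + 3 * (b - a) / 2 * integral {m..b} (\<lambda>x. (b - x) * \<bar>f3 x\<bar>))"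
proof -
  define K h H where "K = integral {a..S} w / (b - a)"
    and "h = integral {a..m} (\<lambda>x. (x - a)\<^sup>2 * \<bar>f3 x\<bar>)"
    and "H = integral {m..b} (\<lambda>x. (b - x) * \<bar>f3 x\<bar>)"
  define r where "r s = f1 s - f1 m - f2 m * (s - m)" for s
  define g where "g s = integral {s..m} (\<lambda>x. (x - s) * \<bar>f3 x\<bar>)" for s
  define u where "u p = v p - taylor2 v f1 f2 m p" for p
  have am: "a < m" "m < b" using assms(1) m by auto
  have bm: "b - m = (b - a) / 2" using m by (simp add: field_simps)
  have jm: "jet3 {a<..m} v f1 f2 f3" and jmb: "jet3 {m..b} v f1 f2 f3"
    using am by (auto intro!: jet3_subset[OF jet])
  have f3c: "continuous_on {m..b} f3" by (rule jet3_continuous(4)[OF jmb])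
  note g = derivative_remainder_integrable[OF am(1) jm int, folded g_def r_def h_def]
  have wmS: "w integrable_on {m..S}"
    using am S by (intro integrable_subinterval_real[OF wS]) auto
  have K: "0 \<le> K" "integral {a..S} w = K * (b - a)" unfolding K_def
    using assms(1) wS w0 by (auto intro!: divide_nonneg_pos Henstock_Kurzweil_Integration.integral_nonneg)
  have Hint: "(\<lambda>x. (b - x) * \<bar>f3 x\<bar>) integrable_on {m..b}"
    by (intro integrable_continuous_real continuous_intros f3c)
  have h0: "0 \<le> h" unfolding h_def using int by (intro Henstock_Kurzweil_Integration.integral_nonneg) auto
  have H0: "0 \<le> H" unfolding H_def using Hint by (intro Henstock_Kurzweil_Integration.integral_nonneg) auto
  have hi: "((\<lambda>s. w s * r s) has_integral integral {a..S} (\<lambda>s. w s * f1 s) - integral {a..S} w * f1 m - 0 * f2 m) {a..S}"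
  proof -
    have "((\<lambda>s. w s * f1 s - w s * f1 m - (s - m) * w s * f2 m) has_integral integral {a..S} (\<lambda>s. w s * f1 s) - integral {a..S} w * f1 m - 0 * f2 m) {a..S}"
      by (intro has_integral_diff has_integral_mult_left integrable_integral wf wS orth)
    then show ?thesis by (simp add: r_def algebra_simps)
  qed
  have "u b - u a = v b - v a - f1 m * (b - a) - f2 m * ((b - m)\<^sup>2 - (a - m)\<^sup>2) / 2"
    by (simp add: u_def taylor2_def field_simps)
  also have "(b - m)\<^sup>2 - (a - m)\<^sup>2 = 0" unfolding m by (simp add: power2_eq_square field_simps)
  finally have vba: "v b - v a = f1 m * (b - a) + (u b - u a)" by simp
  have "integral {a..S} (\<lambda>s. w s * f1 s) = integral {a..S} (\<lambda>s. w s * r s) + K * (b - a) * f1 m"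
    using integral_unique[OF hi] K(2) by simp
  then have split: "integral {a..S} (\<lambda>s. w s * f1 s) - K * (v b - v a)
      = integral {a..S} (\<lambda>s. w s * r s) - K * (u b - u a)"
    unfolding vba by (simp add: algebra_simps)
  have ua: "\<bar>u a\<bar> \<le> h / 2"
    unfolding u_def h_def using am by (intro taylor_remainder_left jm int continuous_on_subset[OF cont]) auto
  have ub: "\<bar>u b\<bar> \<le> (b - a) * H / 4"
  proof -
    have "integral {m..b} (\<lambda>x. (b - x)\<^sup>2 * \<bar>f3 x\<bar>) \<le> integral {m..b} (\<lambda>x. (b - a) / 2 * ((b - x) * \<bar>f3 x\<bar>))"
    proof (rule integral_le)
      fix x assume x: "x \<in> {m..b}"
      have "(b - x) * ((b - x) * \<bar>f3 x\<bar>) \<le> (b - a) / 2 * ((b - x) * \<bar>f3 x\<bar>)"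
        using x bm by (intro mult_right_mono) auto
      then show "(b - x)\<^sup>2 * \<bar>f3 x\<bar> \<le> (b - a) / 2 * ((b - x) * \<bar>f3 x\<bar>)"
        by (simp add: power2_eq_square mult.assoc)
    qed (intro integrable_continuous_real continuous_intros f3c)+
    also have "\<dots> = (b - a) * H / 2" unfolding H_def by simp
    finally show ?thesis
      unfolding u_def using taylor_remainder_right[OF jmb] am by simp
  qed
  have wr1: "(\<lambda>s. w s * r s) integrable_on {a..m}" and wr2: "(\<lambda>s. w s * r s) integrable_on {m..S}"
    using am S by (intro integrable_subinterval_real[OF has_integral_integrable[OF hi]]; simp)+
  have comb: "integral {a..S} (\<lambda>s. w s * r s) = integral {a..m} (\<lambda>s. w s * r s) + integral {m..S} (\<lambda>s. w s * r s)"
    using am S by (intro Henstock_Kurzweil_Integration.integral_combine[symmetric] has_integral_integrable[OF hi]) auto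
  have left: "\<bar>integral {a..m} (\<lambda>s. w s * r s)\<bar> \<le> K * h"
  proof -
    have gi: "(\<lambda>s. w m * g s) integrable_on {a<..<m}"
      using integrable_cmul[OF g(1), of "w m"] by (simp add: integrable_on_Icc_iff_Ioo)
    have "norm (integral {a<..<m} (\<lambda>s. w s * r s)) \<le> integral {a<..<m} (\<lambda>s. w m * g s)"
    proof (rule integral_norm_bound_integral[OF _ gi])
      show "(\<lambda>s. w s * r s) integrable_on {a<..<m}" using wr1 by (simp add: integrable_on_Icc_iff_Ioo)
      fix s assume s: "s \<in> {a<..<m}"
      have "w s * \<bar>r s\<bar> \<le> w m * g s"
        using s S w0[of s] w0[of m] by (intro mult_mono w_mono g(3)) auto
      then show "norm (w s * r s) \<le> w m * g s" using s S w0[of s] by (simp add: abs_mult)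
    qed
    then have "\<bar>integral {a..m} (\<lambda>s. w s * r s)\<bar> \<le> w m * integral {a..m} g"
      by (simp add: integral_open_interval_real)
    also have "\<dots> \<le> w m * (h / 2)" using g(2) w0[of m] S by (intro mult_left_mono) auto
    also have "\<dots> \<le> (2 * K) * (h / 2)"
      using wm h0 unfolding K_def[symmetric] by (intro mult_right_mono) auto
    finally show ?thesis by simp
  qed
  have right: "\<bar>integral {m..S} (\<lambda>s. w s * r s)\<bar> \<le> K * (b - a) * H"
  proof -
    have wH: "(\<lambda>s. w s * H) integrable_on {m..S}"
      using wmS by (rule integrable_on_mult_left)
    have "norm (integral {m..S} (\<lambda>s. w s * r s)) \<le> integral {m..S} (\<lambda>s. w s * H)"
    proof (rule integral_norm_bound_integral[OF wr2 wH])
      fix s assume s: "s \<in> {m..S}"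
      have js: "jet3 {m..s} v f1 f2 f3" using s S by (intro jet3_subset[OF jmb]) auto
      have ms: "m \<le> s" using s by simp
      have hs: "((\<lambda>x. (s - x) * f3 x) has_integral r s) {m..s}"
        using taylor1_has_integral[OF js ms, of s] by (simp add: r_def algebra_simps)
      have sub: "(\<lambda>x. (b - x) * \<bar>f3 x\<bar>) integrable_on {m..s}"
        using s S by (intro integrable_subinterval_real[OF Hint]) auto
      have "norm (integral {m..s} (\<lambda>x. (s - x) * f3 x)) \<le> integral {m..s} (\<lambda>x. (b - x) * \<bar>f3 x\<bar>)"
        using s S hs by (intro integral_norm_bound_integral sub)
          (auto simp: abs_mult integrable_on_def intro!: mult_right_mono)
      also have "\<dots> \<le> H"
        unfolding H_def using s S by (intro integral_subset_le sub Hint) auto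
      finally have "\<bar>r s\<bar> \<le> H" unfolding integral_unique[OF hs] by simp
      then show "norm (w s * r s) \<le> w s * H"
        using s w0[of s] by (simp add: abs_mult mult_left_mono)
    qed
    also have "\<dots> = integral {m..S} w * H" by simp
    also have "\<dots> \<le> integral {a..S} w * H"
      using am S w0 H0 by (intro mult_right_mono integral_subset_le wmS wS) auto
    finally show ?thesis using K(2) by simp
  qed
  have "\<bar>integral {a..S} (\<lambda>s. w s * f1 s) - K * (v b - v a)\<bar>
      \<le> \<bar>integral {a..m} (\<lambda>s. w s * r s)\<bar> + \<bar>integral {m..S} (\<lambda>s. w s * r s)\<bar> + K * \<bar>u b - u a\<bar>"
  proof -
    have "K * \<bar>u b - u a\<bar> = \<bar>K * (u b - u a)\<bar>" using K(1) by (simp add: abs_mult)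
    then show ?thesis
      unfolding split comb by (simp only: order_trans[OF abs_triangle_ineq4 add_right_mono[OF abs_triangle_ineq]])
  qed
  also have "\<dots> \<le> K * h + K * (b - a) * H + K * ((b - a) * H / 4 + h / 2)"
    using left right ua ub K(1) by (intro add_mono mult_left_mono) auto
  also have "\<dots> = K * (3 / 2 * h + 5 / 4 * ((b - a) * H))" by (simp add: field_simps)
  also have "\<dots> \<le> K * (3 / 2 * h + 3 / 2 * ((b - a) * H))"
    using K(1) H0 assms(1) by (intro mult_left_mono add_left_mono mult_right_mono mult_nonneg_nonneg) auto
  also have "\<dots> = K * (3 / 2 * h + 3 * (b - a) / 2 * H)" by simp
  finally show ?thesis unfolding K_def h_def H_def .
qed

end

section \<open>The weakly singular kernel\<close>

lemma Gamma_pos: "\<alpha> < 1 \<Longrightarrow> 0 < Gamma (1 - \<alpha> :: real)"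
  by (rule Gamma_real_pos) simp

lemma powr_has_derivative_reflected:
  fixes p S x :: real
  assumes "x < S"
  shows "((\<lambda>s. (S - s) powr p) has_real_derivative - (p * (S - x) powr (p - 1))) (at x)"
  using assms by (auto intro!: derivative_eq_intros)

lemma convex_kernel_omega:
  assumes "0 < \<alpha>" "\<alpha> < 1"
  shows "convex_kernel S (\<lambda>s. omega (1 - \<alpha>) (S - s)) (\<lambda>s. \<alpha> / Gamma (1 - \<alpha>) * (S - s) powr (- \<alpha> - 1))"
proof
  fix x y :: real
  note G = Gamma_pos[OF assms(2)]
  show "((\<lambda>s. omega (1 - \<alpha>) (S - s)) has_real_derivative \<alpha> / Gamma (1 - \<alpha>) * (S - x) powr (- \<alpha> - 1)) (at x)"
    if "x < S"
    unfolding omega_def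
    using DERIV_cdivide[OF powr_has_derivative_reflected[OF that, of "- \<alpha>"], of "Gamma (1 - \<alpha>)"] by simp
  show "0 \<le> \<alpha> / Gamma (1 - \<alpha>) * (S - x) powr (- \<alpha> - 1)" if "x < S"
    using G assms by simp
  show "\<alpha> / Gamma (1 - \<alpha>) * (S - x) powr (- \<alpha> - 1) \<le> \<alpha> / Gamma (1 - \<alpha>) * (S - y) powr (- \<alpha> - 1)"
    if "x \<le> y" "y < S"
    using G assms that by (intro mult_left_mono powr_mono2') auto
  show "continuous_on {..<S} (\<lambda>s. \<alpha> / Gamma (1 - \<alpha>) * (S - s) powr (- \<alpha> - 1))"
    by (intro continuous_intros) auto
qed

lemma omega_nonneg: "\<alpha> < 1 \<Longrightarrow> 0 \<le> omega (1 - \<alpha>) x"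
  using Gamma_pos[of \<alpha>] by (simp add: omega_def)

lemma omega_has_integral:
  assumes "0 < \<alpha>" "\<alpha> < 1" "a \<le> S"
  shows "((\<lambda>s. omega (1 - \<alpha>) (S - s)) has_integral (S - a) powr (1 - \<alpha>) / ((1 - \<alpha>) * Gamma (1 - \<alpha>))) {a..S}"
proof -
  let ?F = "\<lambda>s. - ((S - s) powr (1 - \<alpha>) / ((1 - \<alpha>) * Gamma (1 - \<alpha>)))"
  have "((\<lambda>s. omega (1 - \<alpha>) (S - s)) has_integral ?F S - ?F a) {a..S}"
  proof (rule fundamental_theorem_of_calculus_interior[OF assms(3)])
    show "continuous_on {a..S} ?F"
      using assms Gamma_pos[OF assms(2), THEN less_imp_neq, symmetric]
      by (intro continuous_on_minus continuous_on_divide continuous_on_powr' continuous_on_diff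
            continuous_on_const continuous_on_id) auto
    fix x assume "x \<in> {a<..<S}"
    then have "x < S" by simp
    from DERIV_minus[OF DERIV_cdivide[OF powr_has_derivative_reflected[OF this, of "1 - \<alpha>"], of "(1 - \<alpha>) * Gamma (1 - \<alpha>)"]]
    show "(?F has_vector_derivative omega (1 - \<alpha>) (S - x)) (at x)"
      using assms Gamma_pos[OF assms(2)]
      by (simp add: omega_def flip: has_real_derivative_iff_has_vector_derivative)
  qed
  then show ?thesis by simp
qed

text \<open>
This identity is what singles out the offset \<open>\<theta> = \<alpha> / 2\<close>. With \<open>L = S - a\<close> the integral is a multiple of
\<open>L powr (1 - \<alpha>) * ((S - m) / (1 - \<alpha>) - L / (2 - \<alpha>))\<close>, \<open>m\<close> being the midpoint, and for this offset both
quotients equal half the step size.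
\<close>

lemma omega_offset_orthogonal:
  assumes \<alpha>: "0 < \<alpha>" "\<alpha> < 1" and "a < b" and S: "S = \<alpha> / 2 * a + (1 - \<alpha> / 2) * b"
  shows "((\<lambda>s. (s - (a + b) / 2) * omega (1 - \<alpha>) (S - s)) has_integral 0) {a..S}"
proof -
  let ?m = "(a + b) / 2"
  have Sm: "S - ?m = (1 - \<alpha>) * (b - a) / 2" and Sa: "S - a = (2 - \<alpha>) * (b - a) / 2"
    unfolding S by (simp_all add: field_simps)
  have "0 < S - a" unfolding Sa using \<alpha> \<open>a < b\<close> by simp
  then have aS: "a < S" by simp
  let ?F = "\<lambda>s. ((S - s) powr (2 - \<alpha>) / (2 - \<alpha>) - (S - ?m) * ((S - s) powr (1 - \<alpha>) / (1 - \<alpha>))) / Gamma (1 - \<alpha>)"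
  have hi: "((\<lambda>s. (s - ?m) * omega (1 - \<alpha>) (S - s)) has_integral ?F S - ?F a) {a..S}"
  proof (rule fundamental_theorem_of_calculus_interior)
    show "continuous_on {a..S} ?F"
      using \<alpha> Gamma_pos[OF \<alpha>(2), THEN less_imp_neq, symmetric]
      by (intro continuous_on_mult continuous_on_divide continuous_on_powr' continuous_on_diff
            continuous_on_const continuous_on_id) auto
    fix x assume x: "x \<in> {a<..<S}"
    then have xS: "x < S" by simp
    have "(?F has_real_derivative (- ((2 - \<alpha>) * (S - x) powr (2 - \<alpha> - 1)) / (2 - \<alpha>)
        - (S - ?m) * (- ((1 - \<alpha>) * (S - x) powr (1 - \<alpha> - 1)) / (1 - \<alpha>))) / Gamma (1 - \<alpha>)) (at x)"
      by (intro DERIV_cdivide DERIV_diff DERIV_cmult powr_has_derivative_reflected xS)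
    moreover have "(S - x) powr (2 - \<alpha> - 1) = (S - x) * (S - x) powr (- \<alpha>)"
      using powr_mult_base[of "S - x" "- \<alpha>"] xS by (simp add: algebra_simps)
    ultimately have "(?F has_real_derivative (- ((S - x) * (S - x) powr (- \<alpha>)) + (S - ?m) * (S - x) powr (- \<alpha>)) / Gamma (1 - \<alpha>)) (at x)"
      using \<alpha> by simp
    moreover have "(- ((S - x) * p) + (S - ?m) * p) / Gamma (1 - \<alpha>) = (x - ?m) * (p / Gamma (1 - \<alpha>))" for p
      by (simp add: algebra_simps add_divide_distrib diff_divide_distrib)
    ultimately show "(?F has_vector_derivative (x - ?m) * omega (1 - \<alpha>) (S - x)) (at x)"
      by (simp only: omega_def has_real_derivative_iff_has_vector_derivative) simp
  qed (use aS in simp)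
  have "(S - a) powr (2 - \<alpha>) = (S - a) * (S - a) powr (1 - \<alpha>)"
    using powr_mult_base[of "S - a" "1 - \<alpha>"] aS by (simp add: algebra_simps)
  then have "?F a = ((S - a) / (2 - \<alpha>) - (S - ?m) / (1 - \<alpha>)) * (S - a) powr (1 - \<alpha>) / Gamma (1 - \<alpha>)"
    by (simp add: left_diff_distrib)
  moreover have "(S - a) / (2 - \<alpha>) - (S - ?m) / (1 - \<alpha>) = 0"
    unfolding Sm Sa using \<alpha> by (simp add: field_simps)
  ultimately have "?F a = 0" by (simp only: mult_zero_left div_0)
  moreover have "?F S = 0" by simp
  ultimately show ?thesis using hi by (metis diff_zero)
qed

text \<open>
The integral over \<open>[a, S]\<close> is divided by the full step \<open>b - a\<close>, as in \<open>coeff_a\<close>. The first inequality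
is \<open>(S - m) powr (1 - \<alpha>) \<le> (S - a) powr (1 - \<alpha>)\<close> up to the factor \<open>2 / ((1 - \<alpha>) * (b - a))\<close>, which is the
reciprocal of \<open>S - m\<close>; the second holds because \<open>S - a\<close> is at least \<open>(1 - \<alpha>) * (b - a)\<close>.
\<close>

lemma omega_le_offset_mean:
  assumes \<alpha>: "0 < \<alpha>" "\<alpha> < 1" and "a < b" and S: "S = \<alpha> / 2 * a + (1 - \<alpha> / 2) * b"
  shows "omega (1 - \<alpha>) (S - (a + b) / 2) \<le> 2 * (integral {a..S} (\<lambda>s. omega (1 - \<alpha>) (S - s)) / (b - a))"
    and "omega (1 - \<alpha>) (S - a) \<le> integral {a..S} (\<lambda>s. omega (1 - \<alpha>) (S - s)) / (b - a)"
proof -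
  let ?m = "(a + b) / 2"
  have Sm: "S - ?m = (1 - \<alpha>) * (b - a) / 2" and Sa: "S - a = (2 - \<alpha>) * (b - a) / 2"
    unfolding S by (simp_all add: field_simps)
  have pos: "0 < S - ?m" "S - ?m \<le> S - a" "0 < S - a"
    unfolding Sm Sa using \<alpha> \<open>a < b\<close> by (auto intro!: mult_right_mono)
  have I: "integral {a..S} (\<lambda>s. omega (1 - \<alpha>) (S - s)) = (S - a) powr (1 - \<alpha>) / ((1 - \<alpha>) * Gamma (1 - \<alpha>))"
    using omega_has_integral[OF \<alpha>, of a S] pos by (intro integral_unique) auto
  have G: "0 < Gamma (1 - \<alpha>)" using \<alpha> by (intro Gamma_pos)
  have scale: "p / Gamma (1 - \<alpha>) \<le> q / ((1 - \<alpha>) * Gamma (1 - \<alpha>)) / (b - a)"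
    if "p * ((1 - \<alpha>) * (b - a)) \<le> q" for p q
  proof -
    have "p \<le> q / ((1 - \<alpha>) * (b - a))"
      using that \<alpha> \<open>a < b\<close> by (subst pos_le_divide_eq) auto
    then have "p / Gamma (1 - \<alpha>) \<le> q / ((1 - \<alpha>) * (b - a)) / Gamma (1 - \<alpha>)"
      using G by (intro divide_right_mono) auto
    then show ?thesis by (simp add: mult_ac)
  qed
  have "(S - ?m) powr (- \<alpha>) * (S - ?m) \<le> (S - a) powr (1 - \<alpha>)"
    using powr_mult_base[of "S - ?m" "- \<alpha>"] pos \<alpha> powr_mono2[of "1 - \<alpha>" "S - ?m" "S - a"]
    by (simp add: mult.commute)
  then have "(S - ?m) powr (- \<alpha>) * ((1 - \<alpha>) * (b - a) / 2) \<le> (S - a) powr (1 - \<alpha>)"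
    unfolding Sm .
  then show "omega (1 - \<alpha>) (S - ?m) \<le> 2 * (integral {a..S} (\<lambda>s. omega (1 - \<alpha>) (S - s)) / (b - a))"
    unfolding I unfolding omega_def using scale[of "(S - ?m) powr (- \<alpha>)" "2 * (S - a) powr (1 - \<alpha>)"] by simp
  have "(S - a) powr (- \<alpha>) * ((1 - \<alpha>) * (b - a)) \<le> (S - a) powr (- \<alpha>) * (S - a)"
    unfolding Sa using \<alpha> \<open>a < b\<close> by (intro mult_left_mono) (auto simp: field_simps)
  also have "\<dots> = (S - a) powr (1 - \<alpha>)"
    using powr_mult_base[of "S - a" "- \<alpha>"] pos by (simp add: mult.commute)
  finally show "omega (1 - \<alpha>) (S - a) \<le> integral {a..S} (\<lambda>s. omega (1 - \<alpha>) (S - s)) / (b - a)"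
    unfolding I unfolding omega_def using scale by simp
qed

section \<open>The discrete kernels on the mesh\<close>

text \<open>
The only place where the bound on the step ratios enters. In terms of \<open>\<rho> = p / q\<close> it says
\<open>\<rho> ^ 3 \<le> 12 / 5 * (1 + \<rho>)\<close>.
\<close>

lemma cubic_ratio_bound:
  fixes p q :: real
  assumes "0 < p" "0 < q" "p \<le> 7 / 4 * q"
  shows "p ^ 3 / 6 / (p + q) \<le> 2 / 5 * q\<^sup>2"
proof -
  have "p * p \<le> (7 / 4 * q) * (7 / 4 * q)" using assms by (intro mult_mono) auto
  then have "p * (p * p) \<le> p * (49 / 16 * q\<^sup>2)"
    using assms by (intro mult_left_mono) (auto simp: power2_eq_square)
  also have "\<dots> = (49 / 16 * p) * q\<^sup>2" by simp
  also have "\<dots> \<le> (12 / 5 * (p + q)) * q\<^sup>2"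
    using assms by (intro mult_right_mono) auto
  finally have "p ^ 3 / 6 \<le> 2 / 5 * q\<^sup>2 * (p + q)" by (simp add: power3_eq_cube algebra_simps)
  then show ?thesis using pos_divide_le_eq[OF add_pos_pos[OF assms(1,2)]] by metis
qed

lemma sum_convolution_swap:
  fixes f :: "nat \<Rightarrow> nat \<Rightarrow> 'a :: comm_monoid_add"
  shows "(\<Sum>k = 1..n. \<Sum>j = 1..k - 1. f k j) = (\<Sum>j = 1..n - 1. \<Sum>k = j + 1..n. f k j)"
proof -
  have "(\<Sum>k = 1..n. \<Sum>j = 1..k - 1. f k j) = (\<Sum>k = 1..n. \<Sum>j = 1..n - 1. if j < k then f k j else 0)"
    by (intro sum.cong refl sum.mono_neutral_cong_left) auto
  also have "\<dots> = (\<Sum>j = 1..n - 1. \<Sum>k = 1..n. if j < k then f k j else 0)"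
    by (rule sum.swap)
  also have "\<dots> = (\<Sum>j = 1..n - 1. \<Sum>k = j + 1..n. f k j)"
    by (intro sum.cong refl sum.mono_neutral_cong_right) auto
  finally show ?thesis .
qed

locale alikhanov_mesh =
  fixes \<alpha> \<theta> :: real and t :: "nat \<Rightarrow> real" and N :: nat
  assumes \<alpha>: "0 < \<alpha>" "\<alpha> < 1" and \<theta>: "\<theta> = \<alpha> / 2"
    and t_step: "k < N \<Longrightarrow> t k < t (Suc k)"
    and ratio: "1 \<le> k \<Longrightarrow> k \<le> N - 1 \<Longrightarrow> rho t k \<le> 7 / 4"
begin

definition varpi'' :: "nat \<Rightarrow> real \<Rightarrow> real" where
  "varpi'' n s = \<alpha> / Gamma (1 - \<alpha>) * (t_off \<theta> t n - s) powr (- \<alpha> - 1)"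

lemma kernel: "convex_kernel (t_off \<theta> t n) (varpi' \<alpha> \<theta> t n) (varpi'' n)"
  using convex_kernel_omega[OF \<alpha>, of "t_off \<theta> t n"]
  by (simp add: varpi'_def[abs_def] varpi''_def[abs_def])

lemma t_mono: "i \<le> j \<Longrightarrow> j \<le> N \<Longrightarrow> t i \<le> t j"
proof (induction j)
  case (Suc j)
  then show ?case using t_step[of j] by (cases "i = Suc j") auto
qed simp

lemma t_less: "1 \<le> k \<Longrightarrow> k \<le> N \<Longrightarrow> t (k - 1) < t k"
  using t_step[of "k - 1"] by simp

lemma tau_pos: "1 \<le> k \<Longrightarrow> k \<le> N \<Longrightarrow> 0 < tau t k"
  using t_less by (simp add: tau_def)

lemma t_off_alt: "t_off \<theta> t n = \<alpha> / 2 * t (n - 1) + (1 - \<alpha> / 2) * t n"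
  by (simp add: t_off_def \<theta>)

lemma t_off_bounds:
  assumes "1 \<le> n" "n \<le> N"
  shows "t_mid t n < t_off \<theta> t n" "t_off \<theta> t n \<le> t n" "t (n - 1) < t_mid t n"
proof -
  have d: "0 < t n - t (n - 1)" using t_less[OF assms] by simp
  have "t_off \<theta> t n - t_mid t n = (1 - \<alpha>) / 2 * (t n - t (n - 1))"
    by (simp add: t_off_alt t_mid_def field_simps)
  moreover have "0 < (1 - \<alpha>) / 2 * (t n - t (n - 1))" using d \<alpha> by simp
  ultimately show "t_mid t n < t_off \<theta> t n" by linarith
  have "t n - t_off \<theta> t n = \<alpha> / 2 * (t n - t (n - 1))"
    by (simp add: t_off_alt field_simps)
  moreover have "0 \<le> \<alpha> / 2 * (t n - t (n - 1))" using d \<alpha> by simp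
  ultimately show "t_off \<theta> t n \<le> t n" by linarith
  show "t (n - 1) < t_mid t n" using d by (simp add: t_mid_def)
qed

lemma t_less_off:
  assumes "k < n" "n \<le> N"
  shows "t k < t_off \<theta> t n"
  using t_mono[of k "n - 1"] t_off_bounds[of n] assms by force

lemma varpi'_nonneg: "0 \<le> varpi' \<alpha> \<theta> t n s"
  unfolding varpi'_def by (rule omega_nonneg[OF \<alpha>(2)])

lemma varpi'_integrable_to_off:
  assumes "a \<le> t_off \<theta> t n"
  shows "varpi' \<alpha> \<theta> t n integrable_on {a..t_off \<theta> t n}"
  using omega_has_integral[OF \<alpha> assms] by (auto simp: integrable_on_def varpi'_def[abs_def])

text \<open>
The two weighted integrals of \<open>varpi''\<close> over the \<open>k\<close>-th cell that measure the gaps between the discrete kernels;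
\<open>bubble_moment\<close> is \<open>coeff_b\<close> up to normalisation.
\<close>

definition left_moment :: "nat \<Rightarrow> nat \<Rightarrow> real" where
  "left_moment n k = integral {t (k - 1)..t k} (\<lambda>s. (t k - s) * varpi'' n s)"

definition bubble_moment :: "nat \<Rightarrow> nat \<Rightarrow> real" where
  "bubble_moment n k = integral {t (k - 1)..t k} (\<lambda>s. (s - t (k - 1)) * (t k - s) * varpi'' n s)"

lemma coeff_a_history:
  assumes "1 \<le> k" "k < n" "n \<le> N"
  shows "coeff_a \<alpha> \<theta> t n (n - k) = integral {t (k - 1)..t k} (varpi' \<alpha> \<theta> t n) / tau t k"
proof -
  have "min (t k) (t_off \<theta> t n) = t k" using t_less_off[OF assms(2,3)] by simp
  moreover have "continuous_on {t (k - 1)..t k} (varpi' \<alpha> \<theta> t n)"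
    by (rule convex_kernel.continuous_w[OF kernel t_less_off[OF assms(2,3)]])
  ultimately show ?thesis
    using assms by (simp add: coeff_a_def Let_def LBINT_eq_integral_of_continuous)
qed

lemma coeff_a_local:
  assumes "1 \<le> n" "n \<le> N"
  shows "coeff_a \<alpha> \<theta> t n 0 = integral {t (n - 1)..t_off \<theta> t n} (varpi' \<alpha> \<theta> t n) / tau t n"
proof -
  let ?S = "t_off \<theta> t n"
  have aS: "t (n - 1) \<le> ?S" using t_off_bounds[OF assms] by simp
  have "continuous_on {t (n - 1)<..<?S} (varpi' \<alpha> \<theta> t n)"
    by (intro continuous_at_imp_continuous_on ballI DERIV_isCont[OF convex_kernel.w_deriv[OF kernel]]) auto
  then have "(LBINT s:{t (n - 1)<..<?S}. varpi' \<alpha> \<theta> t n s) = integral {t (n - 1)..?S} (varpi' \<alpha> \<theta> t n)"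
    by (rule LBINT_eq_integral_of_dominated(2)[OF _ varpi'_integrable_to_off[OF aS]])
       (simp add: varpi'_nonneg)
  moreover have "min (t n) ?S = ?S" using t_off_bounds[OF assms] by simp
  ultimately show ?thesis by (simp add: coeff_a_def)
qed

lemma coeff_b_eq:
  assumes "1 \<le> k" "k < n" "n \<le> N"
  shows "coeff_b \<alpha> \<theta> t n (n - k) = 2 / (tau t k * (tau t k + tau t (k + 1))) *
      integral {t (k - 1)..t k} (\<lambda>s. (s - t_mid t k) * varpi' \<alpha> \<theta> t n s)"
    and "coeff_b \<alpha> \<theta> t n (n - k) = bubble_moment n k / (tau t k * (tau t k + tau t (k + 1)))"
proof -
  have S: "t k < t_off \<theta> t n" and ab: "t (k - 1) \<le> t k"
    using t_less_off t_less[of k] assms by auto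
  have c: "continuous_on {t (k - 1)..t k} (\<lambda>s. (s - t_mid t k) * varpi' \<alpha> \<theta> t n s)"
    by (intro continuous_intros convex_kernel.continuous_w[OF kernel S])
  show *: "coeff_b \<alpha> \<theta> t n (n - k) = 2 / (tau t k * (tau t k + tau t (k + 1))) *
      integral {t (k - 1)..t k} (\<lambda>s. (s - t_mid t k) * varpi' \<alpha> \<theta> t n s)"
    using assms LBINT_eq_integral_of_continuous[OF c] by (simp add: coeff_b_def Let_def)
  have "bubble_moment n k = 2 * integral {t (k - 1)..t k} (\<lambda>s. (s - t_mid t k) * varpi' \<alpha> \<theta> t n s)"
    unfolding bubble_moment_def t_mid_def
    by (rule integral_unique[OF convex_kernel.moment_bubble[OF kernel ab S]])
  then show "coeff_b \<alpha> \<theta> t n (n - k) = bubble_moment n k / (tau t k * (tau t k + tau t (k + 1)))"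
    unfolding * by simp
qed

text \<open>
The coefficient \<open>b\<close> of the \<open>k\<close>-th cell, extended by zero to \<open>k = 0\<close> and \<open>k = n\<close>. With this convention a single
formula, \<open>kern_A_eq\<close>, covers the four cases in the definition of \<open>kern_A\<close>; \<open>rho t 0\<close> only ever occurs with
the factor zero.
\<close>

definition history_b :: "nat \<Rightarrow> nat \<Rightarrow> real" where
  "history_b n k = (if 1 \<le> k \<and> k < n then coeff_b \<alpha> \<theta> t n (n - k) else 0)"

lemma history_b_nonneg:
  assumes "n \<le> N"
  shows "0 \<le> history_b n k"
proof (cases "1 \<le> k \<and> k < n")
  case True
  then have S: "t k < t_off \<theta> t n" and ab: "t (k - 1) \<le> t k"
    using t_less_off t_less[of k] assms by auto
  have "0 \<le> bubble_moment n k"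
    unfolding bubble_moment_def by (rule convex_kernel.bubble_nonneg[OF kernel ab S])
  moreover have "0 < tau t k" "0 < tau t (k + 1)"
    using True assms by (auto intro!: tau_pos)
  ultimately show ?thesis
    using True assms by (simp add: history_b_def coeff_b_eq(2))
qed (auto simp: history_b_def)

lemma kern_A_eq:
  assumes "1 \<le> k" "k \<le> n"
  shows "kern_A \<alpha> \<theta> t n (n - k)
    = coeff_a \<alpha> \<theta> t n (n - k) + rho t (k - 1) * history_b n (k - 1) - history_b n k"
proof -
  consider "n = 1" "k = 1" | "n \<ge> 2" "k = n" | "n \<ge> 2" "k = 1" | "2 \<le> k" "k < n"
    using assms by linarith
  then show ?thesis
  proof cases
    case 4
    then have "n - k - 1 < n" "n - (n - k) - 1 = k - 1" "n - k \<noteq> n - 1" "n - (k - 1) = n - k + 1" by auto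
    moreover have "1 \<le> k - 1" "k - 1 < n" "n - k \<noteq> 0" "n \<noteq> 1" using 4 by auto
    ultimately show ?thesis using 4 by (simp only: kern_A_def history_b_def if_True if_False simp_thms) simp
  qed (auto simp: kern_A_def history_b_def)
qed

lemma kern_A_0_pos:
  assumes "1 \<le> n" "n \<le> N"
  shows "coeff_a \<alpha> \<theta> t n 0 \<le> kern_A \<alpha> \<theta> t n 0" "0 < kern_A \<alpha> \<theta> t n 0"
proof -
  have "0 \<le> rho t (n - 1) * history_b n (n - 1)"
  proof (cases "n = 1")
    case False
    then have "0 < tau t (n - 1)" "0 < tau t n" using assms by (auto intro!: tau_pos)
    then have "0 \<le> rho t (n - 1)" using assms by (simp add: rho_def)
    then show ?thesis using history_b_nonneg assms by simp
  qed (simp add: history_b_def)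
  moreover have "kern_A \<alpha> \<theta> t n (n - n) = coeff_a \<alpha> \<theta> t n (n - n) + rho t (n - 1) * history_b n (n - 1) - history_b n n"
    by (rule kern_A_eq) (use assms in auto)
  ultimately show *: "coeff_a \<alpha> \<theta> t n 0 \<le> kern_A \<alpha> \<theta> t n 0" by (simp add: history_b_def)
  have "0 < omega (1 - \<alpha>) (t_off \<theta> t n - t (n - 1))"
    using Gamma_pos[OF \<alpha>(2)] t_off_bounds[OF assms] by (simp add: omega_def)
  also have "\<dots> \<le> coeff_a \<alpha> \<theta> t n 0"
    using omega_le_offset_mean(2)[OF \<alpha> t_less[OF assms] t_off_alt]
    by (simp add: coeff_a_local[OF assms] varpi'_def[abs_def] tau_def)
  finally show "0 < kern_A \<alpha> \<theta> t n 0" using * by simp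
qed

text \<open>
On a past cell the excess of the average of \<open>varpi'\<close> over its value at the left end point is the left
moment divided by \<open>tau t j\<close>, and \<open>coeff_b\<close> is at most that. On the current cell the division by the full
step, although the integral stops at the offset point, is harmless by \<open>omega_le_offset_mean\<close>.
\<close>

lemma coeff_a_minus_b_ge:
  assumes "1 \<le> j" "j \<le> n" "n \<le> N"
  shows "varpi' \<alpha> \<theta> t n (t (j - 1)) \<le> coeff_a \<alpha> \<theta> t n (n - j) - history_b n j"
proof (cases "j = n")
  case True
  have "1 \<le> n" using assms by simp
  then show ?thesis
    using omega_le_offset_mean(2)[OF \<alpha> t_less[OF _ assms(3)] t_off_alt] coeff_a_local[OF _ assms(3)] True
    by (simp add: varpi'_def[abs_def] tau_def history_b_def)
next
  case False
  then have jn: "j < n" using assms by simp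
  have S: "t j < t_off \<theta> t n" and ab: "t (j - 1) \<le> t j" using t_less_off[OF jn assms(3)] t_less[of j] assms by auto
  have tj: "0 < tau t j" "0 < tau t (j + 1)" using assms jn by (auto intro!: tau_pos)
  have L: "left_moment n j = integral {t (j - 1)..t j} (varpi' \<alpha> \<theta> t n) - tau t j * varpi' \<alpha> \<theta> t n (t (j - 1))"
    unfolding left_moment_def tau_def
    by (rule integral_unique[OF convex_kernel.moment_left[OF kernel ab S]])
  have bub: "0 \<le> bubble_moment n j" "bubble_moment n j \<le> tau t j * left_moment n j"
    unfolding bubble_moment_def left_moment_def tau_def
    using convex_kernel.bubble_nonneg[OF kernel ab S] convex_kernel.bubble_le_left[OF kernel ab S] by auto
  have "history_b n j = bubble_moment n j / (tau t j * (tau t j + tau t (j + 1)))"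
    using assms jn by (simp add: history_b_def coeff_b_eq(2))
  also have "\<dots> \<le> bubble_moment n j / (tau t j * tau t j)"
    using tj bub by (intro divide_left_mono mult_left_mono mult_pos_pos) auto
  also have "\<dots> \<le> tau t j * left_moment n j / (tau t j * tau t j)"
    using tj bub by (intro divide_right_mono) auto
  also have "\<dots> = left_moment n j / tau t j" using tj by simp
  also have "\<dots> = coeff_a \<alpha> \<theta> t n (n - j) - varpi' \<alpha> \<theta> t n (t (j - 1))"
    unfolding coeff_a_history[OF assms(1) jn assms(3)] L using tj by (simp add: diff_divide_distrib)
  finally show ?thesis by simp
qed

text \<open>
The gap between \<open>varpi'\<close> at the right end point and its average is \<open>R / tau t k\<close>, where \<open>R\<close> is the right
moment. Four fifths of \<open>R\<close> absorb the contribution of the preceding cell, since \<open>R\<close> is at least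
\<open>(tau t k)\<^sup>2 / 2\<close> times the value of \<open>varpi''\<close> at the point shared with that cell, which is the largest
value of \<open>varpi''\<close> there. The remaining fifth dominates the left moment.
\<close>

lemma coeff_a_plus_rho_b_le:
  assumes "1 \<le> k" "k < n" "n \<le> N"
  shows "coeff_a \<alpha> \<theta> t n (n - k) + rho t (k - 1) * history_b n (k - 1) + left_moment n k / (5 * tau t k)
    \<le> varpi' \<alpha> \<theta> t n (t k)"
proof -
  have S: "t k < t_off \<theta> t n" and ab: "t (k - 1) \<le> t k" using t_less_off[OF assms(2,3)] t_less[of k] assms by auto
  have tk: "0 < tau t k" using assms by (auto intro!: tau_pos)
  define R where "R = integral {t (k - 1)..t k} (\<lambda>s. (s - t (k - 1)) * varpi'' n s)"
  have R: "R = tau t k * varpi' \<alpha> \<theta> t n (t k) - integral {t (k - 1)..t k} (varpi' \<alpha> \<theta> t n)"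
    unfolding R_def tau_def by (rule integral_unique[OF convex_kernel.moment_right[OF kernel ab S]])
  have RL: "left_moment n k \<le> R"
    unfolding R_def left_moment_def by (rule convex_kernel.left_le_right[OF kernel ab S])
  have Rw: "(tau t k)\<^sup>2 / 2 * varpi'' n (t (k - 1)) \<le> R"
    unfolding R_def tau_def by (rule convex_kernel.right_ge_endpoint[OF kernel ab S])
  have w0: "0 \<le> varpi'' n (t (k - 1))"
    using S ab by (intro convex_kernel.w1_nonneg[OF kernel]) auto
  have b: "rho t (k - 1) * history_b n (k - 1) \<le> 2 / 5 * (tau t k)\<^sup>2 * varpi'' n (t (k - 1)) / tau t k"
  proof (cases "k = 1")
    case True
    then show ?thesis using w0 tk by (simp add: history_b_def)
  next
    case False
    let ?p = "tau t (k - 1)"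
    have k: "1 \<le> k - 1" "k - 1 < n" "k - 1 + 1 = k" using False assms by auto
    have p: "0 < ?p" using k assms by (intro tau_pos) auto
    have "rho t (k - 1) \<le> 7 / 4" using False assms by (intro ratio) auto
    then have pq: "?p \<le> 7 / 4 * tau t k"
      using tk k by (simp add: rho_def pos_divide_le_eq)
    have S': "t (k - 1) < t_off \<theta> t n" and ab': "t (k - 1 - 1) \<le> t (k - 1)"
      using S ab t_less[of "k - 1"] k assms by auto
    have bub: "bubble_moment n (k - 1) \<le> ?p ^ 3 / 6 * varpi'' n (t (k - 1))"
      unfolding bubble_moment_def tau_def by (rule convex_kernel.bubble_le_endpoint[OF kernel ab' S'])
    have "history_b n (k - 1) = bubble_moment n (k - 1) / (?p * (?p + tau t k))"
      using k coeff_b_eq(2)[OF k(1,2) assms(3)] by (simp add: history_b_def)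
    then have "rho t (k - 1) * history_b n (k - 1) = bubble_moment n (k - 1) / (?p + tau t k) / tau t k"
      using p tk k by (simp add: rho_def)
    also have "\<dots> \<le> ?p ^ 3 / 6 * varpi'' n (t (k - 1)) / (?p + tau t k) / tau t k"
      using bub p tk by (intro divide_right_mono) auto
    also have "\<dots> = ?p ^ 3 / 6 / (?p + tau t k) * varpi'' n (t (k - 1)) / tau t k" by simp
    also have "\<dots> \<le> 2 / 5 * (tau t k)\<^sup>2 * varpi'' n (t (k - 1)) / tau t k"
      using cubic_ratio_bound[OF p tk pq] w0 tk by (intro divide_right_mono mult_right_mono) auto
    finally show ?thesis .
  qed
  also have "\<dots> \<le> 4 / 5 * R / tau t k"
    using Rw tk by (intro divide_right_mono) auto
  finally have "rho t (k - 1) * history_b n (k - 1) \<le> 4 / 5 * R / tau t k" .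
  moreover have "left_moment n k / (5 * tau t k) \<le> R / (5 * tau t k)"
    using RL tk by (intro divide_right_mono) auto
  moreover have "4 / 5 * R / tau t k + R / (5 * tau t k) = R / tau t k"
    using tk by (simp add: field_simps)
  moreover have "R / tau t k = varpi' \<alpha> \<theta> t n (t k) - coeff_a \<alpha> \<theta> t n (n - k)"
    unfolding coeff_a_history[OF assms] R using tk by (simp add: diff_divide_distrib)
  ultimately show ?thesis by linarith
qed

text \<open>
Both averages are compared with the value of \<open>varpi'\<close> at the common mesh point \<open>t k\<close>.
\<close>

lemma kern_A_diff_ge:
  assumes "1 \<le> k" "k < n" "n \<le> N"
  shows "left_moment n k / (5 * tau t k) + (1 + rho t k) * history_b n k
    \<le> kern_A \<alpha> \<theta> t n (n - k - 1) - kern_A \<alpha> \<theta> t n (n - k)"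
proof -
  have "kern_A \<alpha> \<theta> t n (n - (k + 1)) = coeff_a \<alpha> \<theta> t n (n - (k + 1)) + rho t k * history_b n k - history_b n (k + 1)"
    using kern_A_eq[of "k + 1" n] assms by simp
  moreover have "kern_A \<alpha> \<theta> t n (n - k) = coeff_a \<alpha> \<theta> t n (n - k) + rho t (k - 1) * history_b n (k - 1) - history_b n k"
    using kern_A_eq[of k n] assms by simp
  moreover have "varpi' \<alpha> \<theta> t n (t k) \<le> coeff_a \<alpha> \<theta> t n (n - (k + 1)) - history_b n (k + 1)"
    using coeff_a_minus_b_ge[of "k + 1" n] assms by simp
  moreover note coeff_a_plus_rho_b_le[OF assms]
  ultimately show ?thesis by (simp add: algebra_simps)
qed

lemma rho_nonneg: "1 \<le> k \<Longrightarrow> k < N \<Longrightarrow> 0 \<le> rho t k"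
  using tau_pos[of k] tau_pos[of "k + 1"] by (simp add: rho_def)

lemma left_moment_nonneg:
  assumes "1 \<le> k" "k < n" "n \<le> N"
  shows "0 \<le> left_moment n k"
proof -
  have S: "t k < t_off \<theta> t n" and ab: "t (k - 1) \<le> t k" using t_less_off[OF assms(2,3)] t_less[of k] assms by auto
  show ?thesis unfolding left_moment_def
    using convex_kernel.moment_left[OF kernel ab S] convex_kernel.w1_nonneg[OF kernel] S
    by (intro Henstock_Kurzweil_Integration.integral_nonneg) (auto simp: integrable_on_def)
qed

lemma kern_A_diff_nonneg:
  assumes "1 \<le> k" "k < n" "n \<le> N"
  shows "0 \<le> kern_A \<alpha> \<theta> t n (n - k - 1) - kern_A \<alpha> \<theta> t n (n - k)"
proof -
  have "0 \<le> left_moment n k / (5 * tau t k)"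
    using left_moment_nonneg[OF assms] tau_pos[of k] assms by simp
  moreover have "0 \<le> (1 + rho t k) * history_b n k"
    using history_b_nonneg[OF assms(3)] rho_nonneg[of k] assms by simp
  ultimately show ?thesis using kern_A_diff_ge[OF assms] by linarith
qed

lemma kern_P_nonneg:
  assumes "m < n" "n \<le> N"
  shows "0 \<le> kern_P \<alpha> \<theta> t n m"
  using assms(1)
proof (induction m rule: less_induct)
  case (less m)
  show ?case
  proof (cases "m = 0")
    case True
    then show ?thesis using kern_A_0_pos(2)[of n] assms by (simp add: kern_P.simps)
  next
    case False
    let ?j = "n - m"
    have j: "1 \<le> ?j" "?j \<le> N" using less.prems assms by auto
    have "0 \<le> (kern_A \<alpha> \<theta> t k (k - ?j - 1) - kern_A \<alpha> \<theta> t k (k - ?j)) * kern_P \<alpha> \<theta> t n (n - k)"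
      if "k \<in> {?j + 1..n}" for k
      using that j assms False by (intro mult_nonneg_nonneg kern_A_diff_nonneg less.IH) auto
    then have "0 \<le> (\<Sum>k = ?j + 1..n. (kern_A \<alpha> \<theta> t k (k - ?j - 1) - kern_A \<alpha> \<theta> t k (k - ?j)) * kern_P \<alpha> \<theta> t n (n - k))"
      by (rule sum_nonneg)
    then show ?thesis
      using False kern_A_0_pos(2)[OF j] by (subst kern_P.simps) simp
  qed
qed

lemma kern_P_complementary:
  assumes "1 \<le> j" "j < n" "n \<le> N"
  shows "(\<Sum>k = j + 1..n. (kern_A \<alpha> \<theta> t k (k - j - 1) - kern_A \<alpha> \<theta> t k (k - j)) * kern_P \<alpha> \<theta> t n (n - k))
    = kern_P \<alpha> \<theta> t n (n - j) * kern_A \<alpha> \<theta> t j 0"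
proof -
  have nj: "n - j \<noteq> 0" "n - (n - j) = j" using assms by auto
  have "kern_A \<alpha> \<theta> t j 0 \<noteq> 0" using kern_A_0_pos(2)[of j] assms by simp
  then show ?thesis using assms(2) by (simp add: nj kern_P.simps[of \<alpha> \<theta> t n "n - j"])
qed

text \<open>
After the exchange of summations the weights collected by \<open>H j\<close> form the sum that
\<open>kern_P_complementary\<close> evaluates, so the kernels that enter depend on \<open>j\<close> and \<open>n\<close> only.
\<close>

lemma global_bound_of_local_bound:
  fixes e G H :: "nat \<Rightarrow> real"
  assumes n: "n \<le> N"
    and e: "\<And>k. 1 \<le> k \<Longrightarrow> k \<le> n \<Longrightarrow> e k \<le> kern_A \<alpha> \<theta> t k 0 * G k
      + (\<Sum>j = 1..k - 1. (kern_A \<alpha> \<theta> t k (k - j - 1) - kern_A \<alpha> \<theta> t k (k - j)) * H j)"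
  shows "(\<Sum>k = 1..n. kern_P \<alpha> \<theta> t n (n - k) * e k)
    \<le> (\<Sum>k = 1..n. kern_P \<alpha> \<theta> t n (n - k) * kern_A \<alpha> \<theta> t k 0 * G k)
      + (\<Sum>k = 1..n - 1. kern_P \<alpha> \<theta> t n (n - k) * kern_A \<alpha> \<theta> t k 0 * H k)"
proof -
  let ?P = "\<lambda>k. kern_P \<alpha> \<theta> t n (n - k)" and ?A = "\<lambda>k. kern_A \<alpha> \<theta> t k 0"
  let ?D = "\<lambda>k j. kern_A \<alpha> \<theta> t k (k - j - 1) - kern_A \<alpha> \<theta> t k (k - j)"
  have "(\<Sum>k = 1..n. ?P k * e k) \<le> (\<Sum>k = 1..n. ?P k * (?A k * G k + (\<Sum>j = 1..k - 1. ?D k j * H j)))"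
    using n e by (intro sum_mono mult_left_mono kern_P_nonneg) auto
  also have "\<dots> = (\<Sum>k = 1..n. ?P k * ?A k * G k) + (\<Sum>k = 1..n. \<Sum>j = 1..k - 1. ?D k j * ?P k * H j)"
    by (simp add: distrib_left sum.distrib sum_distrib_left mult_ac)
  also have "(\<Sum>k = 1..n. \<Sum>j = 1..k - 1. ?D k j * ?P k * H j) = (\<Sum>j = 1..n - 1. (\<Sum>k = j + 1..n. ?D k j * ?P k) * H j)"
    unfolding sum_distrib_right by (rule sum_convolution_swap)
  also have "\<dots> = (\<Sum>j = 1..n - 1. ?P j * ?A j * H j)"
    using n by (intro sum.cong refl arg_cong2[where f = "(*)"] kern_P_complementary) auto
  finally show ?thesis .
qed

end

section \<open>The consistency error\<close>

text \<open>
The functions \<open>f1\<close>, \<open>f2\<close>, \<open>f3\<close> are the derivatives of \<open>v\<close> on the half-open interval. They agree with the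
iterated \<open>deriv\<close> in the interior, and unlike those they are continuous up to the final time.
\<close>

locale alikhanov_consistency = alikhanov_mesh +
  fixes v f1 f2 f3 :: "real \<Rightarrow> real"
  assumes N: "1 \<le> N" and t0: "t 0 = 0"
    and cont: "continuous_on {0..t N} v" and jet: "jet3 {0<..t N} v f1 f2 f3"
    and loc_finite: "1 \<le> k \<Longrightarrow> k \<le> N \<Longrightarrow> G_loc_finite t v k"
    and his_finite: "1 \<le> k \<Longrightarrow> k \<le> N - 1 \<Longrightarrow> G_his_finite t v k"
begin

lemma t_nonneg: "k \<le> N \<Longrightarrow> 0 \<le> t k"
  using t_mono[of 0 k] t0 by simp

lemma derivs_eq:
  assumes "x \<in> {0<..<t N}"
  shows "deriv v x = f1 x" "(deriv ^^ 3) v x = f3 x"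
proof -
  let ?I = "{0<..<t N}"
  have I: "open ?I" "?I \<subseteq> {0<..t N}" by auto
  note d = jet3_interior[OF jet I]
  have ev: "\<forall>\<^sub>F y in nhds x. f y = g y" if "\<And>y. y \<in> ?I \<Longrightarrow> f y = g y" "x \<in> ?I" for f g :: "real \<Rightarrow> real" and x
    using that eventually_nhds_in_open[OF I(1) that(2)] by (auto elim: eventually_mono)
  have d1: "deriv v y = f1 y" if "y \<in> ?I" for y using d(1)[OF that] by (rule DERIV_imp_deriv)
  have d2: "deriv (deriv v) y = f2 y" if "y \<in> ?I" for y
    using deriv_cong_ev[OF ev[OF d1 that] refl] DERIV_imp_deriv[OF d(2)[OF that]] by simp
  have d3: "deriv (deriv (deriv v)) y = f3 y" if "y \<in> ?I" for y
    using deriv_cong_ev[OF ev[OF d2 that] refl] DERIV_imp_deriv[OF d(3)[OF that]] by simp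
  show "deriv v x = f1 x" "(deriv ^^ 3) v x = f3 x"
    using d1 d3 assms by (simp_all add: numeral_3_eq_3)
qed

lemma weighted_third_derivative:
  assumes "0 \<le> x" "y \<le> t N" "set_integrable lborel {x<..<y} (\<lambda>s. p s * \<bar>(deriv ^^ 3) v s\<bar>)"
  shows "(\<lambda>s. p s * \<bar>f3 s\<bar>) integrable_on {x..y}"
    and "(LBINT s:{x<..<y}. p s * \<bar>(deriv ^^ 3) v s\<bar>) = integral {x..y} (\<lambda>s. p s * \<bar>f3 s\<bar>)"
proof -
  have eq: "p s * \<bar>(deriv ^^ 3) v s\<bar> = p s * \<bar>f3 s\<bar>" if "s \<in> {x<..<y}" for s
    using derivs_eq(2)[of s] that assms by simp
  have *: "set_integrable lborel {x<..<y} (\<lambda>s. p s * \<bar>f3 s\<bar>)"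
    using assms(3) eq by (subst (asm) set_integrable_cong[OF refl refl]) auto
  show "(\<lambda>s. p s * \<bar>f3 s\<bar>) integrable_on {x..y}"
    using set_borel_integral_eq_integral(1)[OF *] by (simp add: integrable_on_Icc_iff_Ioo)
  have "(LBINT s:{x<..<y}. p s * \<bar>(deriv ^^ 3) v s\<bar>) = (LBINT s:{x<..<y}. p s * \<bar>f3 s\<bar>)"
    using eq by (intro set_lebesgue_integral_cong) auto
  then show "(LBINT s:{x<..<y}. p s * \<bar>(deriv ^^ 3) v s\<bar>) = integral {x..y} (\<lambda>s. p s * \<bar>f3 s\<bar>)"
    using set_borel_integral_eq_integral(2)[OF *] by (simp add: integral_open_interval_real)
qed

lemma G_loc_eq:
  assumes k: "1 \<le> k" "k \<le> N"
  shows "(\<lambda>s. (s - t (k - 1))\<^sup>2 * \<bar>f3 s\<bar>) integrable_on {t (k - 1)..t_mid t k}"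
    and "G_loc t v k = 3 / 2 * integral {t (k - 1)..t_mid t k} (\<lambda>s. (s - t (k - 1))\<^sup>2 * \<bar>f3 s\<bar>)
       + 3 * tau t k / 2 * integral {t_mid t k..t k} (\<lambda>s. (t k - s) * \<bar>f3 s\<bar>)"
proof -
  have b: "0 \<le> t (k - 1)" "t_mid t k \<le> t N" "0 \<le> t_mid t k" "t k \<le> t N"
  proof -
    have "k - 1 \<le> N" using k by simp
    from t_nonneg[OF this] t_off_bounds[OF k] t_mono[OF k(2) order.refl]
    show "0 \<le> t (k - 1)" "t_mid t k \<le> t N" "0 \<le> t_mid t k" "t k \<le> t N" by linarith+
  qed
  note fin = loc_finite[OF k, unfolded G_loc_finite_def]
  show "(\<lambda>s. (s - t (k - 1))\<^sup>2 * \<bar>f3 s\<bar>) integrable_on {t (k - 1)..t_mid t k}"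
    by (rule weighted_third_derivative(1)[OF b(1,2) conjunct1[OF fin]])
  show "G_loc t v k = 3 / 2 * integral {t (k - 1)..t_mid t k} (\<lambda>s. (s - t (k - 1))\<^sup>2 * \<bar>f3 s\<bar>)
       + 3 * tau t k / 2 * integral {t_mid t k..t k} (\<lambda>s. (t k - s) * \<bar>f3 s\<bar>)"
    unfolding G_loc_def weighted_third_derivative(2)[OF b(1,2) conjunct1[OF fin]]
      weighted_third_derivative(2)[OF b(3,4) conjunct2[OF fin]] ..
qed

lemma G_his_eq:
  assumes k: "1 \<le> k" "k < N"
  shows "(\<lambda>s. (s - t (k - 1))\<^sup>2 * \<bar>f3 s\<bar>) integrable_on {t (k - 1)..t k}"
    and "(\<lambda>s. (t (k + 1) - s)\<^sup>2 * \<bar>f3 s\<bar>) integrable_on {t k..t (k + 1)}"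
    and "G_his t v k = 5 / 2 * integral {t (k - 1)..t k} (\<lambda>s. (s - t (k - 1))\<^sup>2 * \<bar>f3 s\<bar>)
       + 5 / 2 * integral {t k..t (k + 1)} (\<lambda>s. (t (k + 1) - s)\<^sup>2 * \<bar>f3 s\<bar>)"
proof -
  have b: "0 \<le> t (k - 1)" "t k \<le> t N" "0 \<le> t k" "t (k + 1) \<le> t N"
    using t_nonneg[of "k - 1"] t_nonneg[of k] t_mono[of k N] t_mono[of "k + 1" N] k by auto
  have "k \<le> N - 1" using k by simp
  note fin = his_finite[OF k(1) this, unfolded G_his_finite_def]
  show "(\<lambda>s. (s - t (k - 1))\<^sup>2 * \<bar>f3 s\<bar>) integrable_on {t (k - 1)..t k}"
    by (rule weighted_third_derivative(1)[OF b(1,2) conjunct1[OF fin]])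
  show "(\<lambda>s. (t (k + 1) - s)\<^sup>2 * \<bar>f3 s\<bar>) integrable_on {t k..t (k + 1)}"
    by (rule weighted_third_derivative(1)[OF b(3,4) conjunct2[OF fin]])
  show "G_his t v k = 5 / 2 * integral {t (k - 1)..t k} (\<lambda>s. (s - t (k - 1))\<^sup>2 * \<bar>f3 s\<bar>)
       + 5 / 2 * integral {t k..t (k + 1)} (\<lambda>s. (t (k + 1) - s)\<^sup>2 * \<bar>f3 s\<bar>)"
    unfolding G_his_def weighted_third_derivative(2)[OF b(1,2) conjunct1[OF fin]]
      weighted_third_derivative(2)[OF b(3,4) conjunct2[OF fin]] ..
qed

lemma caputo_eq_integral:
  assumes n: "1 \<le> n" "n \<le> N"
  shows "(\<lambda>s. varpi' \<alpha> \<theta> t n s * f1 s) integrable_on {0..t_off \<theta> t n}"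
    and "caputo \<alpha> v (t_off \<theta> t n) = integral {0..t_off \<theta> t n} (\<lambda>s. varpi' \<alpha> \<theta> t n s * f1 s)"
proof -
  let ?S = "t_off \<theta> t n"
  have S: "?S \<le> t N" "0 \<le> ?S"
    using t_off_bounds[OF n] t_mono[of n N] t_less_off[of 0 n] n t0 by auto
  have y: "0 < t_mid t 1" using t_off_bounds(3)[of 1] N t0 by simp
  have yS: "t_mid t 1 < ?S"
  proof (cases "n = 1")
    case False
    then show ?thesis
      using t_less_off[of 1 n] t_off_bounds[of 1] n N by simp
  qed (use t_off_bounds(1)[OF n] in simp)
  have int: "(\<lambda>x. (x - 0)\<^sup>2 * \<bar>f3 x\<bar>) integrable_on {0..t_mid t 1}"
    using G_loc_eq(1)[of 1] N t0 by simp
  have *: "set_integrable lborel {0<..<?S} (\<lambda>s. varpi' \<alpha> \<theta> t n s * f1 s)"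
    by (rule convex_kernel.weighted_derivative_set_integrable
        [OF kernel y yS S(1) jet int varpi'_integrable_to_off[OF S(2)] varpi'_nonneg])
  show "(\<lambda>s. varpi' \<alpha> \<theta> t n s * f1 s) integrable_on {0..?S}"
    using set_borel_integral_eq_integral(1)[OF *] by (simp add: integrable_on_Icc_iff_Ioo)
  have "caputo \<alpha> v ?S = (LBINT s:{0<..<?S}. varpi' \<alpha> \<theta> t n s * f1 s)"
    unfolding caputo_def varpi'_def
    using derivs_eq(1) S by (intro set_lebesgue_integral_cong) auto
  then show "caputo \<alpha> v ?S = integral {0..?S} (\<lambda>s. varpi' \<alpha> \<theta> t n s * f1 s)"
    using set_borel_integral_eq_integral(2)[OF *] by (simp add: integral_open_interval_real)
qed

lemma integral_split_mesh:
  fixes f :: "real \<Rightarrow> real"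
  assumes n: "1 \<le> n" "n \<le> N" and f: "f integrable_on {0..t_off \<theta> t n}"
  shows "integral {0..t_off \<theta> t n} f
    = (\<Sum>k = 1..n - 1. integral {t (k - 1)..t k} f) + integral {t (n - 1)..t_off \<theta> t n} f"
proof -
  have "integral {0..t j} f = (\<Sum>k = 1..j. integral {t (k - 1)..t k} f)" if "j < n" for j
    using that
  proof (induction j)
    case (Suc j)
    have "0 \<le> t j" "t j \<le> t (Suc j)" "t (Suc j) \<le> t_off \<theta> t n"
      using Suc.prems n t_nonneg[of j] t_step[of j] t_less_off[of "Suc j" n] by auto
    then have "integral {0..t (Suc j)} f = integral {0..t j} f + integral {t j..t (Suc j)} f"
      by (intro Henstock_Kurzweil_Integration.integral_combine[symmetric] integrable_subinterval_real[OF f]) auto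
    then show ?case using Suc by simp
  qed (simp add: t0)
  moreover have "integral {0..t_off \<theta> t n} f = integral {0..t (n - 1)} f + integral {t (n - 1)..t_off \<theta> t n} f"
    using t_nonneg[of "n - 1"] t_less_off[of "n - 1" n] n
    by (intro Henstock_Kurzweil_Integration.integral_combine[symmetric] f) auto
  ultimately show ?thesis using n by simp
qed

text \<open>
Summation by parts of the definition: the coefficients \<open>coeff_b\<close>, which \<open>kern_A\<close> attaches to two
consecutive differences, are collected cell by cell.
\<close>

lemma alikhanov_eq:
  assumes n: "1 \<le> n"
  shows "alikhanov \<alpha> \<theta> t v n
    = (\<Sum>k = 1..n - 1. coeff_a \<alpha> \<theta> t n (n - k) * (v (t k) - v (t (k - 1)))
        + coeff_b \<alpha> \<theta> t n (n - k) * (rho t k * (v (t (k + 1)) - v (t k)) - (v (t k) - v (t (k - 1)))))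
      + coeff_a \<alpha> \<theta> t n 0 * (v (t n) - v (t (n - 1)))"
proof -
  let ?d = "\<lambda>k. v (t k) - v (t (k - 1))"
  let ?a = "\<lambda>k. coeff_a \<alpha> \<theta> t n (n - k)" and ?b = "history_b n"
  obtain m where m: "n = Suc m" using n by (cases n) auto
  have "alikhanov \<alpha> \<theta> t v n = (\<Sum>k = 1..n. (?a k + rho t (k - 1) * ?b (k - 1) - ?b k) * ?d k)"
    unfolding alikhanov_def by (intro sum.cong refl) (simp add: kern_A_eq)
  also have "\<dots> = (\<Sum>k = 1..n. ?a k * ?d k) + (\<Sum>k = 1..n. rho t (k - 1) * ?b (k - 1) * ?d k) - (\<Sum>k = 1..n. ?b k * ?d k)"
    by (simp add: algebra_simps sum.distrib sum_subtractf)
  also have "(\<Sum>k = 1..n. rho t (k - 1) * ?b (k - 1) * ?d k) = (\<Sum>k = 1..n - 1. rho t k * ?b k * ?d (k + 1))"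
  proof -
    have "(\<Sum>k = 1..n. rho t (k - 1) * ?b (k - 1) * ?d k) = (\<Sum>k = 0..m. rho t k * ?b k * ?d (k + 1))"
      unfolding m One_nat_def sum.shift_bounds_cl_Suc_ivl by simp
    also have "\<dots> = (\<Sum>k = 1..m. rho t k * ?b k * ?d (k + 1))"
      by (subst sum.atLeast_Suc_atMost) (auto simp: history_b_def)
    finally show ?thesis by (simp add: m)
  qed
  also have "(\<Sum>k = 1..n. ?b k * ?d k) = (\<Sum>k = 1..n - 1. ?b k * ?d k)"
    unfolding m by (simp add: history_b_def)
  also have "(\<Sum>k = 1..n. ?a k * ?d k) = (\<Sum>k = 1..n - 1. ?a k * ?d k) + ?a n * ?d n"
    unfolding m by simp
  also have "(\<Sum>k = 1..n - 1. ?a k * ?d k) + ?a n * ?d n + (\<Sum>k = 1..n - 1. rho t k * ?b k * ?d (k + 1)) - (\<Sum>k = 1..n - 1. ?b k * ?d k)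
      = (\<Sum>k = 1..n - 1. ?a k * ?d k + ?b k * (rho t k * ?d (k + 1) - ?d k)) + ?a n * ?d n"
    by (simp add: algebra_simps sum.distrib sum_subtractf)
  also have "(\<Sum>k = 1..n - 1. ?a k * ?d k + ?b k * (rho t k * ?d (k + 1) - ?d k))
      = (\<Sum>k = 1..n - 1. ?a k * ?d k + coeff_b \<alpha> \<theta> t n (n - k) * (rho t k * ?d (k + 1) - ?d k))"
    by (intro sum.cong refl) (auto simp: history_b_def)
  finally show ?thesis by simp
qed

lemma interpolant_integral:
  assumes k: "1 \<le> k" "k < n" "n \<le> N"
  shows "((\<lambda>s. varpi' \<alpha> \<theta> t n s * quad_interp_deriv v (t (k - 1)) (t k) (t (k + 1)) s) has_integral
    coeff_a \<alpha> \<theta> t n (n - k) * (v (t k) - v (t (k - 1)))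
      + coeff_b \<alpha> \<theta> t n (n - k) * (rho t k * (v (t (k + 1)) - v (t k)) - (v (t k) - v (t (k - 1))))) {t (k - 1)..t k}"
proof -
  let ?a = "t (k - 1)" and ?b = "t k" and ?c = "t (k + 1)"
  let ?w = "varpi' \<alpha> \<theta> t n"
  define d1 d2 where "d1 = (v ?b - v ?a) / (?b - ?a)"
    and "d2 = ((v ?c - v ?b) / (?c - ?b) - (v ?b - v ?a) / (?b - ?a)) / (?c - ?a)"
  have S: "?b < t_off \<theta> t n" by (rule t_less_off[OF k(2,3)])
  note cw = convex_kernel.continuous_w[OF kernel S, of ?a]
  have "(\<lambda>s. (s - t_mid t k) * ?w s) integrable_on {?a..?b}"
    by (intro integrable_continuous_real continuous_intros cw)
  from has_integral_add[OF has_integral_mult_right[OF integrable_integral[OF integrable_continuous_real[OF cw]], of d1]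
      has_integral_mult_right[OF integrable_integral[OF this], of "2 * d2"]]
  have "((\<lambda>s. ?w s * quad_interp_deriv v ?a ?b ?c s) has_integral
      d1 * integral {?a..?b} ?w + 2 * d2 * integral {?a..?b} (\<lambda>s. (s - t_mid t k) * ?w s)) {?a..?b}"
  proof (rule has_integral_eq[rotated])
    fix s
    have q: "quad_interp_deriv v ?a ?b ?c s = d1 + d2 * (2 * (s - t_mid t k))"
      unfolding quad_interp_deriv_def d1_def d2_def t_mid_def ..
    show "d1 * ?w s + 2 * d2 * ((s - t_mid t k) * ?w s) = ?w s * quad_interp_deriv v ?a ?b ?c s"
      unfolding q by (simp add: algebra_simps)
  qed
  moreover have "d1 * integral {?a..?b} ?w = coeff_a \<alpha> \<theta> t n (n - k) * (v ?b - v ?a)"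
    unfolding coeff_a_history[OF k] d1_def tau_def by simp
  moreover have "2 * d2 * integral {?a..?b} (\<lambda>s. (s - t_mid t k) * ?w s)
      = coeff_b \<alpha> \<theta> t n (n - k) * (rho t k * (v ?c - v ?b) - (v ?b - v ?a))"
  proof -
    have p: "0 < tau t k" "0 < tau t (k + 1)" using k by (auto intro!: tau_pos)
    have ca: "?b - ?a = tau t k" "?c - ?b = tau t (k + 1)" "?c - ?a = tau t k + tau t (k + 1)"
      by (simp_all add: tau_def)
    have "(y / q - x / p) / (p + q) = 1 / (p * (p + q)) * (p / q * y - x)"
      if "0 < p" "0 < q" for p q x y :: real
      using that by (simp add: divide_simps)
    from this[OF p] have "d2 = 1 / (tau t k * (tau t k + tau t (k + 1))) * (rho t k * (v ?c - v ?b) - (v ?b - v ?a))"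
      unfolding d2_def ca rho_def .
    then show ?thesis unfolding coeff_b_eq(1)[OF k] by simp
  qed
  ultimately show ?thesis by simp
qed

text \<open>
Each of the two terms of \<open>history_bound\<close> is at most \<open>5 / 2\<close> times the kernel difference times its
integral, by \<open>kern_A_diff_ge\<close>; both kernel terms there are nonnegative, so each may be used alone.
\<close>

lemma history_piece_bound:
  assumes k: "1 \<le> k" "k < n" "n \<le> N"
  shows "\<bar>integral {t (k - 1)..t k} (\<lambda>s. varpi' \<alpha> \<theta> t n s * f1 s)
      - (coeff_a \<alpha> \<theta> t n (n - k) * (v (t k) - v (t (k - 1)))
        + coeff_b \<alpha> \<theta> t n (n - k) * (rho t k * (v (t (k + 1)) - v (t k)) - (v (t k) - v (t (k - 1)))))\<bar>
    \<le> (kern_A \<alpha> \<theta> t n (n - k - 1) - kern_A \<alpha> \<theta> t n (n - k)) * G_his t v k"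
proof -
  let ?a = "t (k - 1)" and ?b = "t k" and ?c = "t (k + 1)"
  let ?w = "varpi' \<alpha> \<theta> t n"
  let ?D = "kern_A \<alpha> \<theta> t n (n - k - 1) - kern_A \<alpha> \<theta> t n (n - k)"
  have kN: "k < N" "k + 1 \<le> N" using k by auto
  have abc: "?a < ?b" "?b < ?c" "?b < t_off \<theta> t n"
    using t_less[of k] t_less[of "k + 1"] t_less_off[OF k(2,3)] k by auto
  have cN: "?c \<le> t N" "0 \<le> ?a" using t_mono[of "k + 1" N] t_nonneg[of "k - 1"] kN by auto
  have jk: "jet3 {?a<..?c} v f1 f2 f3" using cN by (intro jet3_subset[OF jet]) auto
  have ck: "continuous_on {?a..?c} v" using cN by (intro continuous_on_subset[OF cont]) auto
  note G = G_his_eq[OF k(1) kN(1)]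
  define h1 h2 where "h1 = integral {?a..?b} (\<lambda>s. (s - ?a)\<^sup>2 * \<bar>f3 s\<bar>)"
    and "h2 = integral {?b..?c} (\<lambda>s. (?c - s)\<^sup>2 * \<bar>f3 s\<bar>)"
  have h: "0 \<le> h1" "0 \<le> h2" unfolding h1_def h2_def
    using G(1,2) by (auto intro!: Henstock_Kurzweil_Integration.integral_nonneg)
  have p: "0 < tau t k" "0 < tau t (k + 1)" using k by (auto intro!: tau_pos)
  have diff: "?w s * (f1 s - quad_interp_deriv v ?a ?b ?c s) + ?w s * quad_interp_deriv v ?a ?b ?c s = ?w s * f1 s" for s
    by (simp add: right_diff_distrib)
  have "((\<lambda>s. ?w s * (f1 s - quad_interp_deriv v ?a ?b ?c s) + ?w s * quad_interp_deriv v ?a ?b ?c s) has_integral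
     integral {?a..?b} (\<lambda>s. ?w s * (f1 s - quad_interp_deriv v ?a ?b ?c s))
      + integral {?a..?b} (\<lambda>s. ?w s * quad_interp_deriv v ?a ?b ?c s)) {?a..?b}"
    using convex_kernel.history_integral[OF kernel abc jk ck] interpolant_integral[OF k]
    by (intro has_integral_add integrable_integral) (auto simp: integrable_on_def)
  then have "integral {?a..?b} (\<lambda>s. ?w s * f1 s) - integral {?a..?b} (\<lambda>s. ?w s * quad_interp_deriv v ?a ?b ?c s)
      = integral {?a..?b} (\<lambda>s. ?w s * (f1 s - quad_interp_deriv v ?a ?b ?c s))"
    unfolding diff by (simp add: integral_unique)
  then have "\<bar>integral {?a..?b} (\<lambda>s. ?w s * f1 s) - integral {?a..?b} (\<lambda>s. ?w s * quad_interp_deriv v ?a ?b ?c s)\<bar>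
      \<le> left_moment n k / tau t k * (h1 / 2) + bubble_moment n k / (tau t (k + 1) * (?c - ?a)) * (h2 / 2)"
    using convex_kernel.history_bound[OF kernel abc jk ck G(1)]
    by (simp add: left_moment_def bubble_moment_def tau_def h1_def h2_def)
  also have "bubble_moment n k / (tau t (k + 1) * (?c - ?a)) = rho t k * history_b n k"
  proof -
    have "?c - ?a = tau t k + tau t (k + 1)" by (simp add: tau_def)
    then show ?thesis using p k by (simp add: history_b_def coeff_b_eq(2)[OF k] rho_def)
  qed
  also have "left_moment n k / tau t k * (h1 / 2) + rho t k * history_b n k * (h2 / 2)
      \<le> ?D * (5 / 2 * h1) + ?D * (5 / 2 * h2)"
  proof -
    have L: "0 \<le> left_moment n k / tau t k" using left_moment_nonneg[OF k] p by simp
    have B: "0 \<le> history_b n k" "0 \<le> rho t k * history_b n k"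
      using history_b_nonneg[OF k(3)] rho_nonneg[OF k(1) kN(1)] by auto
    have "left_moment n k / tau t k / 5 + (history_b n k + rho t k * history_b n k) \<le> ?D"
      using kern_A_diff_ge[OF k] by (simp add: algebra_simps)
    moreover have "X \<le> 5 * D \<and> R \<le> 5 * D" if "X / 5 + (B + R) \<le> D" "0 \<le> X" "0 \<le> B" "0 \<le> R"
      for X B R D :: real
      using that by auto
    ultimately have D: "left_moment n k / tau t k \<le> 5 * ?D" "rho t k * history_b n k \<le> 5 * ?D"
      using L B by blast+
    have "left_moment n k / tau t k * (h1 / 2) \<le> 5 * ?D * (h1 / 2)"
      using D(1) h by (intro mult_right_mono) auto
    also have "\<dots> = ?D * (5 / 2 * h1)" by simp
    finally have e1: "left_moment n k / tau t k * (h1 / 2) \<le> ?D * (5 / 2 * h1)" .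
    have "rho t k * history_b n k * (h2 / 2) \<le> 5 * ?D * (h2 / 2)"
      using D(2) h by (intro mult_right_mono) auto
    also have "\<dots> = ?D * (5 / 2 * h2)" by simp
    finally show ?thesis using e1 by (rule add_mono[rotated])
  qed
  also have "\<dots> = ?D * G_his t v k" unfolding G(3) h1_def h2_def by (simp add: distrib_left)
  finally show ?thesis unfolding integral_unique[OF interpolant_integral[OF k]] .
qed

lemma local_piece_bound:
  assumes n: "1 \<le> n" "n \<le> N"
  shows "\<bar>integral {t (n - 1)..t_off \<theta> t n} (\<lambda>s. varpi' \<alpha> \<theta> t n s * f1 s)
      - coeff_a \<alpha> \<theta> t n 0 * (v (t n) - v (t (n - 1)))\<bar> \<le> kern_A \<alpha> \<theta> t n 0 * G_loc t v n"
proof -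
  let ?a = "t (n - 1)" and ?b = "t n" and ?S = "t_off \<theta> t n" and ?w = "varpi' \<alpha> \<theta> t n"
  have ab: "?a < ?b" by (rule t_less[OF n])
  note S = t_off_bounds[OF n]
  have bN: "?b \<le> t N" "0 \<le> ?a" using t_mono[of n N] t_nonneg[of "n - 1"] n by auto
  have jn: "jet3 {?a<..?b} v f1 f2 f3" using bN by (intro jet3_subset[OF jet]) auto
  have cn: "continuous_on {?a..?b} v" using bN by (intro continuous_on_subset[OF cont]) auto
  have aS: "?a \<le> ?S" using S by simp
  have orth: "((\<lambda>s. (s - t_mid t n) * ?w s) has_integral 0) {?a..?S}"
    unfolding varpi'_def t_mid_def by (rule omega_offset_orthogonal[OF \<alpha> ab t_off_alt])
  have wm: "?w (t_mid t n) \<le> 2 * (integral {?a..?S} ?w / (?b - ?a))"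
    using omega_le_offset_mean(1)[OF \<alpha> ab t_off_alt] by (simp add: varpi'_def[abs_def] t_mid_def)
  have wf: "(\<lambda>s. ?w s * f1 s) integrable_on {?a..?S}"
    using bN by (intro integrable_subinterval_real[OF caputo_eq_integral(1)[OF n]]) auto
  have K: "coeff_a \<alpha> \<theta> t n 0 = integral {?a..?S} ?w / (?b - ?a)"
    using coeff_a_local[OF n] by (simp add: tau_def)
  have "\<bar>integral {?a..?S} (\<lambda>s. ?w s * f1 s) - coeff_a \<alpha> \<theta> t n 0 * (v ?b - v ?a)\<bar> \<le> coeff_a \<alpha> \<theta> t n 0 * G_loc t v n"
    unfolding K G_loc_eq(2)[OF n] unfolding tau_def
    by (rule convex_kernel.local_bound[OF kernel ab t_mid_def S(1,2) jn cn G_loc_eq(1)[OF n]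
        varpi'_integrable_to_off[OF aS] varpi'_nonneg orth wm wf])
  also have "\<dots> \<le> kern_A \<alpha> \<theta> t n 0 * G_loc t v n"
  proof (rule mult_right_mono[OF kern_A_0_pos(1)[OF n]])
    show "0 \<le> G_loc t v n"
      unfolding G_loc_def set_lebesgue_integral_def using tau_pos[OF n]
      by (intro add_nonneg_nonneg mult_nonneg_nonneg Bochner_Integration.integral_nonneg) (auto simp: indicator_def)
  qed
  finally show ?thesis .
qed

lemma local_error_bound:
  assumes n: "1 \<le> n" "n \<le> N"
  shows "\<bar>local_error \<alpha> \<theta> t v n\<bar> \<le> kern_A \<alpha> \<theta> t n 0 * G_loc t v n
    + (\<Sum>k = 1..n - 1. (kern_A \<alpha> \<theta> t n (n - k - 1) - kern_A \<alpha> \<theta> t n (n - k)) * G_his t v k)"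
proof -
  let ?I = "\<lambda>k. integral {t (k - 1)..t k} (\<lambda>s. varpi' \<alpha> \<theta> t n s * f1 s)"
  let ?Q = "\<lambda>k. coeff_a \<alpha> \<theta> t n (n - k) * (v (t k) - v (t (k - 1)))
        + coeff_b \<alpha> \<theta> t n (n - k) * (rho t k * (v (t (k + 1)) - v (t k)) - (v (t k) - v (t (k - 1))))"
  let ?L = "integral {t (n - 1)..t_off \<theta> t n} (\<lambda>s. varpi' \<alpha> \<theta> t n s * f1 s) - coeff_a \<alpha> \<theta> t n 0 * (v (t n) - v (t (n - 1)))"
  have split: "local_error \<alpha> \<theta> t v n = ?L + (\<Sum>k = 1..n - 1. ?I k - ?Q k)"
    unfolding local_error_def caputo_eq_integral(2)[OF n] alikhanov_eq[OF n(1)]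
      integral_split_mesh[OF n caputo_eq_integral(1)[OF n]] sum_subtractf by simp
  have "\<bar>local_error \<alpha> \<theta> t v n\<bar> \<le> \<bar>?L\<bar> + (\<Sum>k = 1..n - 1. \<bar>?I k - ?Q k\<bar>)"
    unfolding split by (rule order_trans[OF abs_triangle_ineq add_left_mono[OF sum_abs]])
  also have "\<dots> \<le> kern_A \<alpha> \<theta> t n 0 * G_loc t v n
      + (\<Sum>k = 1..n - 1. (kern_A \<alpha> \<theta> t n (n - k - 1) - kern_A \<alpha> \<theta> t n (n - k)) * G_his t v k)"
  proof (rule add_mono)
    show "\<bar>?L\<bar> \<le> kern_A \<alpha> \<theta> t n 0 * G_loc t v n" by (rule local_piece_bound[OF n])
    have "\<bar>?I k - ?Q k\<bar> \<le> (kern_A \<alpha> \<theta> t n (n - k - 1) - kern_A \<alpha> \<theta> t n (n - k)) * G_his t v k"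
      if "k \<in> {1..n - 1}" for k
    proof (rule history_piece_bound)
      show "1 \<le> k" "k < n" "n \<le> N" using that n by auto
    qed
    then show "(\<Sum>k = 1..n - 1. \<bar>?I k - ?Q k\<bar>)
        \<le> (\<Sum>k = 1..n - 1. (kern_A \<alpha> \<theta> t n (n - k - 1) - kern_A \<alpha> \<theta> t n (n - k)) * G_his t v k)"
      by (rule sum_mono)
  qed
  finally show ?thesis .
qed

end

lemma Ck_on_3_jet:
  assumes "Ck_on 3 S v"
  obtains f1 f2 f3 where "jet3 S v f1 f2 f3"
proof -
  note Ck = Ck_on.simps(2)[THEN iffD1]
  obtain f1 where f1: "\<forall>x\<in>S. (v has_real_derivative f1 x) (at x within S)" "Ck_on (Suc (Suc 0)) S f1"
    using Ck[OF assms[unfolded numeral_3_eq_3]] by blast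
  obtain f2 where f2: "\<forall>x\<in>S. (f1 has_real_derivative f2 x) (at x within S)" "Ck_on (Suc 0) S f2"
    using Ck[OF f1(2)] by blast
  obtain f3 where f3: "\<forall>x\<in>S. (f2 has_real_derivative f3 x) (at x within S)" "Ck_on 0 S f3"
    using Ck[OF f2(2)] by blast
  from f1(1) f2(1) f3 have "jet3 S v f1 f2 f3" unfolding jet3_def Ck_on.simps(1) by blast
  then show thesis by (rule that)
qed

theorem theorem3p4:
  fixes \<alpha> \<theta> T :: real and N :: nat and t :: "nat \<Rightarrow> real" and v :: "real \<Rightarrow> real"
  assumes alpha: "0 < \<alpha>" "\<alpha> < 1"
    and theta: "\<theta> = \<alpha> / 2"
    and mesh: "1 \<le> N" "t 0 = 0" "\<And>k. k < N \<Longrightarrow> t k < t (Suc k)" "t N = T"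
    and ratio: "\<And>k. 1 \<le> k \<Longrightarrow> k \<le> N - 1 \<Longrightarrow> rho t k \<le> 7 / 4"
    and cont: "continuous_on {0..T} v"
    and smooth: "Ck_on 3 {0<..T} v"
    and loc_finite: "\<And>k. 1 \<le> k \<Longrightarrow> k \<le> N \<Longrightarrow> G_loc_finite t v k"
    and his_finite: "\<And>k. 1 \<le> k \<Longrightarrow> k \<le> N - 1 \<Longrightarrow> G_his_finite t v k"
  shows "(\<forall>n\<in>{1..N}.
            \<bar>local_error \<alpha> \<theta> t v n\<bar>
              \<le> kern_A \<alpha> \<theta> t n 0 * G_loc t v n
                + (\<Sum>k=1..n-1. (kern_A \<alpha> \<theta> t n (n - k - 1) - kern_A \<alpha> \<theta> t n (n - k)) * G_his t v k))
       \<and> (\<forall>n\<in>{1..N}.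
            global_error \<alpha> \<theta> t v n
              \<le> (\<Sum>k=1..n. kern_P \<alpha> \<theta> t n (n - k) * kern_A \<alpha> \<theta> t k 0 * G_loc t v k)
                + (\<Sum>k=1..n-1. kern_P \<alpha> \<theta> t n (n - k) * kern_A \<alpha> \<theta> t k 0 * G_his t v k))"
proof -
  obtain f1 f2 f3 where jet: "jet3 {0<..T} v f1 f2 f3" by (rule Ck_on_3_jet[OF smooth])
  interpret alikhanov_consistency \<alpha> \<theta> t N v f1 f2 f3
    by unfold_locales (use assms jet in auto)
  show ?thesis
  proof (intro conjI ballI)
    fix n assume "n \<in> {1..N}"
    then have n: "1 \<le> n" "n \<le> N" by auto
    show "\<bar>local_error \<alpha> \<theta> t v n\<bar> \<le> kern_A \<alpha> \<theta> t n 0 * G_loc t v n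
        + (\<Sum>k=1..n-1. (kern_A \<alpha> \<theta> t n (n - k - 1) - kern_A \<alpha> \<theta> t n (n - k)) * G_his t v k)"
      by (rule local_error_bound[OF n])
    show "global_error \<alpha> \<theta> t v n
        \<le> (\<Sum>k=1..n. kern_P \<alpha> \<theta> t n (n - k) * kern_A \<alpha> \<theta> t k 0 * G_loc t v k)
          + (\<Sum>k=1..n-1. kern_P \<alpha> \<theta> t n (n - k) * kern_A \<alpha> \<theta> t k 0 * G_his t v k)"
      unfolding global_error_def
    proof (rule global_bound_of_local_bound[OF n(2)])
      fix k assume "1 \<le> k" "k \<le> n"
      then show "\<bar>local_error \<alpha> \<theta> t v k\<bar> \<le> kern_A \<alpha> \<theta> t k 0 * G_loc t v k
          + (\<Sum>j=1..k-1. (kern_A \<alpha> \<theta> t k (k - j - 1) - kern_A \<alpha> \<theta> t k (k - j)) * G_his t v j)"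
        using n by (intro local_error_bound) auto
    qed
  qed
qed

end
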